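(* Let $G$ be a finite group, $V$ an abelian normal subgroup of $G$ of exponent $N$, $k$ a field containing a primitive $N$-th root of $1$, and $F\in k[V]\otimes k[V]$ an element which is an invariant (invertible) Drinfeld twist for $k[G]$; let $\sigma:\widehat V\times\widehat V\to k^\times$ be the corresponding two-cocycle. Let $A=k\langle x_1,\dots,x_n\rangle/(p_i)_{i\in I}$ be a right $G$-algebra (i.e. $G$ acts on the right by algebra automorphisms) in which each generator $x_j$ is an eigenvector for $V$ with character $\chi_j\in\widehat V$; assume that the linear span of the $p_i$ is stable under the action of $V$ on $k\langle x_1,\dots,x_n\rangle$ by algebra automorphisms given by $x_j\cdot v=\chi_j(v)x_j$. Then the twisted algebra $A_F={}_\sigma A$ is presented as $$A_F=k\langle X_1,\dots,X_n\rangle/(\kappa(p_i))_{i\in I},$$ where $X_j$ corresponds to $x_j$ viewed as an element of $A_F$. If $x_ix_j=x_jx_i$ holds in $A$, then in $A_F$ one has $$X_iX_j=b_\sigma(\chi_j,\chi_i)\,X_jX_i .$$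
   Context: An invertible $F\in k[G]\otimes k[G]$ is a Drinfeld twist if $(F\otimes1)(\Delta\otimes\mathrm{id})(F)=(1\otimes F)(\mathrm{id}\otimes\Delta)(F)$; it is invariant if $\Delta(a)F=F\Delta(a)$ for all $a\in k[G]$, where $\Delta(g)=g\otimes g$. The twisted algebra $A_F$ has underlying vector space $A$ and product $a*_Fb=\mu_A((a\otimes b)F)$, with $\mu_A$ the product of $A$ and $k[G]\otimes k[G]$ acting on the right on $A\otimes A$ componentwise. $\widehat V=\mathrm{Hom}(V,k^\times)$ is the character group, and for $\chi\in\widehat V$, $e_\chi=\frac1{|V|}\sum_{v\in V}\chi(v)^{-1}v\in k[V]$ is the corresponding idempotent. The two-cocycle $\sigma$ is defined by $F=\sum_{\chi,\psi\in\widehat V}\sigma(\chi,\psi)\,e_\chi\otimes e_\psi$, and $b_\sigma(\chi,\psi)=\sigma(\psi,\chi)/\sigma(\chi,\psi)$. The element $x_j$ seen in $A_F$ is written $X_j$, and words in the $X_j$ refer to the product $*_F$. The unit of $A_F$ is $\sigma(1,1)^{-1}1_A$. For $r>1$ and $1\le i_1,\dots,i_r\le n$ put $$\kappa_{i_1,\dots,i_r}=\sigma(\chi_{i_1},\chi_{i_2})^{-1}\sigma(\chi_{i_1}\chi_{i_2},\chi_{i_3})^{-1}\cdots\sigma(\chi_{i_1}\cdots\chi_{i_{r-1}},\chi_{i_r})^{-1}.$$ The linear isomorphism $\kappa:k\langle x_1,\dots,x_n\rangle\to k\langle X_1,\dots,X_n\rangle$ is given by $\kappa(x_{i_1}\cdots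 x_{i_r})=\kappa_{i_1,\dots,i_r}X_{i_1}\cdots X_{i_r}$ for $r>1$, $\kappa(x_j)=X_j$, $\kappa(1)=\sigma(1,1)$. *)

theory Defs
  imports "HOL-Algebra.QuotRing" "HOL-Algebra.Module"
begin

section \<open>Associative algebras over a field\<close>

text \<open>
  The ground field is a type \<open>'k\<close> of class \<open>field\<close>; \<open>scalar_ring\<close> is this field as an
  HOL-Algebra ring, so that the library's modules can be used.  The library's locale \<open>algebra\<close>
  is not suitable here, because it only covers commutative algebras.
\<close>

definition scalar_ring :: "'k::field ring" where
  "scalar_ring = \<lparr>carrier = UNIV, mult = (*), one = 1, zero = 0, add = (+)\<rparr>"

locale assoc_algebra = module scalar_ring A + ring A
  for A :: "('k::field, 'a, 'm) module_scheme" +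
  assumes smult_mult_left:
    "\<lbrakk>a \<in> carrier A; b \<in> carrier A\<rbrakk> \<Longrightarrow>
      (c \<odot>\<^bsub>A\<^esub> a) \<otimes>\<^bsub>A\<^esub> b = c \<odot>\<^bsub>A\<^esub> (a \<otimes>\<^bsub>A\<^esub> b)"
  and smult_mult_right:
    "\<lbrakk>a \<in> carrier A; b \<in> carrier A\<rbrakk> \<Longrightarrow>
      a \<otimes>\<^bsub>A\<^esub> (c \<odot>\<^bsub>A\<^esub> b) = c \<odot>\<^bsub>A\<^esub> (a \<otimes>\<^bsub>A\<^esub> b)"

definition alg_iso ::
    "('k::field, 'a, 'm) module_scheme \<Rightarrow> ('k, 'b, 'n) module_scheme \<Rightarrow> ('a \<Rightarrow> 'b) set" where
  "alg_iso A B = {h \<in> ring_iso A B. \<forall>c. \<forall>a\<in>carrier A. h (c \<odot>\<^bsub>A\<^esub> a) = c \<odot>\<^bsub>B\<^esub> h a}"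

definition quotient_algebra ::
    "('k::field, 'a, 'm) module_scheme \<Rightarrow> 'a set \<Rightarrow> ('k, 'a set) module" where
  "quotient_algebra A J =
     ring.extend (A Quot J) (module.fields (\<lambda>c C. \<Union>a\<in>C. J +>\<^bsub>A\<^esub> (c \<odot>\<^bsub>A\<^esub> a)))"

definition linear_span :: "('k::field, 'a, 'm) module_scheme \<Rightarrow> 'a set \<Rightarrow> 'a set" where
  "linear_span A S = \<Inter>{U. submodule U (scalar_ring :: 'k ring) A \<and> S \<subseteq> U}"

locale right_G_algebra = assoc_algebra A + group G
  for A :: "('k::field, 'a, 'm) module_scheme" and G :: "('g, 'n) monoid_scheme" +
  fixes act :: "'a \<Rightarrow> 'g \<Rightarrow> 'a"
  assumes act_aut: "g \<in> carrier G \<Longrightarrow> (\<lambda>a. act a g) \<in> alg_iso A A"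
  and act_one: "a \<in> carrier A \<Longrightarrow> act a \<one>\<^bsub>G\<^esub> = a"
  and act_mult: "\<lbrakk>a \<in> carrier A; g \<in> carrier G; h \<in> carrier G\<rbrakk> \<Longrightarrow>
      act a (g \<otimes>\<^bsub>G\<^esub> h) = act (act a g) h"


section \<open>Free algebras and presentations\<close>

text \<open>
  An element of the free algebra on letters \<open>1, \<dots>, n\<close> is given by its coefficients on words,
  a word being a list of letters.
\<close>

definition free_algebra :: "nat \<Rightarrow> ('k::field, nat list \<Rightarrow> 'k) module" where
  "free_algebra n =
     \<lparr>carrier = {f. finite {w. f w \<noteq> 0} \<and> (\<forall>w. f w \<noteq> 0 \<longrightarrow> set w \<subseteq> {1..n})},
      mult = (\<lambda>f g w. \<Sum>i\<le>length w. f (take i w) * g (drop i w)),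
      one = (\<lambda>w. if w = [] then 1 else 0),
      zero = (\<lambda>w. 0),
      add = (\<lambda>f g w. f w + g w),
      smult = (\<lambda>c f w. c * f w)\<rparr>"

definition free_gen :: "nat \<Rightarrow> nat list \<Rightarrow> 'k::field" where
  "free_gen j = (\<lambda>w. if w = [j] then 1 else 0)"

text \<open>
  \<open>A\<close> is the algebra generated by \<open>x 1, \<dots>, x n\<close> subject to the relators \<open>P\<close>: the free algebra
  modulo the two-sided ideal generated by \<open>P\<close> is isomorphic to \<open>A\<close>, the class of the
  \<open>j\<close>-th free generator corresponding to \<open>x j\<close>.
\<close>

definition presented_as ::
    "('k::field, 'a, 'm) module_scheme \<Rightarrow> nat \<Rightarrow> (nat \<Rightarrow> 'a) \<Rightarrow> (nat list \<Rightarrow> 'k) set \<Rightarrow> bool" where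
  "presented_as A n x P \<longleftrightarrow>
     assoc_algebra A \<and>
     (\<exists>\<theta> \<in> alg_iso (quotient_algebra (free_algebra n) (genideal (free_algebra n) P)) A.
        \<forall>j\<in>{1..n}. \<theta> (genideal (free_algebra n) P +>\<^bsub>free_algebra n :: ('k, nat list \<Rightarrow> 'k) module\<^esub> free_gen j) = x j)"


section \<open>Group algebras and Drinfeld twists\<close>

text \<open>
  For finite \<open>H\<close>, the group algebra consists of the coefficient functions on \<open>H\<close>, extended by
  zero.  Tensor powers of \<open>k[G]\<close> are identified with the group algebras of the
  corresponding direct powers of \<open>G\<close>, via \<open>g \<otimes> h \<mapsto> (g, h)\<close>.
\<close>

definition group_algebra :: "('h, 'm) monoid_scheme \<Rightarrow> ('k::field, 'h \<Rightarrow> 'k) module" where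
  "group_algebra H =
     \<lparr>carrier = {a. \<forall>g. g \<notin> carrier H \<longrightarrow> a g = 0},
      mult = (\<lambda>a b g. \<Sum>(x, y) \<in> {(x, y). x \<in> carrier H \<and> y \<in> carrier H \<and> x \<otimes>\<^bsub>H\<^esub> y = g}. a x * b y),
      one = (\<lambda>g. if g = \<one>\<^bsub>H\<^esub> then 1 else 0),
      zero = (\<lambda>g. 0),
      add = (\<lambda>a b g. a g + b g),
      smult = (\<lambda>c a g. c * a g)\<rparr>"

text \<open>The linear extension of a map \<open>\<phi>\<close> between bases, where \<open>B\<close> is the (finite) basis of the source.\<close>

definition linear_ext :: "'h set \<Rightarrow> ('h \<Rightarrow> 'l) \<Rightarrow> ('h \<Rightarrow> 'k::field) \<Rightarrow> 'l \<Rightarrow> 'k" where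
  "linear_ext B \<phi> a = (\<lambda>y. \<Sum>x\<in>{x \<in> B. \<phi> x = y}. a x)"

definition comult :: "('g, 'm) monoid_scheme \<Rightarrow> ('g \<Rightarrow> 'k::field) \<Rightarrow> 'g \<times> 'g \<Rightarrow> 'k" where
  "comult G = linear_ext (carrier G) (\<lambda>g. (g, g))"

text \<open>The four maps below are \<open>F \<mapsto> F \<otimes> 1\<close>, \<open>F \<mapsto> 1 \<otimes> F\<close>, \<open>\<Delta> \<otimes> id\<close> and \<open>id \<otimes> \<Delta>\<close>.\<close>

definition tensor_one ::
    "('g, 'm) monoid_scheme \<Rightarrow> ('g \<times> 'g \<Rightarrow> 'k::field) \<Rightarrow> 'g \<times> 'g \<times> 'g \<Rightarrow> 'k" where
  "tensor_one G = linear_ext (carrier (G \<times>\<times> G)) (\<lambda>(g, h). (g, h, \<one>\<^bsub>G\<^esub>))"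

definition one_tensor ::
    "('g, 'm) monoid_scheme \<Rightarrow> ('g \<times> 'g \<Rightarrow> 'k::field) \<Rightarrow> 'g \<times> 'g \<times> 'g \<Rightarrow> 'k" where
  "one_tensor G = linear_ext (carrier (G \<times>\<times> G)) (\<lambda>(g, h). (\<one>\<^bsub>G\<^esub>, g, h))"

definition comult_id ::
    "('g, 'm) monoid_scheme \<Rightarrow> ('g \<times> 'g \<Rightarrow> 'k::field) \<Rightarrow> 'g \<times> 'g \<times> 'g \<Rightarrow> 'k" where
  "comult_id G = linear_ext (carrier (G \<times>\<times> G)) (\<lambda>(g, h). (g, g, h))"

definition id_comult ::
    "('g, 'm) monoid_scheme \<Rightarrow> ('g \<times> 'g \<Rightarrow> 'k::field) \<Rightarrow> 'g \<times> 'g \<times> 'g \<Rightarrow> 'k" where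
  "id_comult G = linear_ext (carrier (G \<times>\<times> G)) (\<lambda>(g, h). (g, h, h))"

definition drinfeld_twist :: "('g, 'm) monoid_scheme \<Rightarrow> ('g \<times> 'g \<Rightarrow> 'k::field) \<Rightarrow> bool" where
  "drinfeld_twist G F \<longleftrightarrow>
     F \<in> Units (group_algebra (G \<times>\<times> G) :: ('k, 'g \<times> 'g \<Rightarrow> 'k) module) \<and>
     tensor_one G F \<otimes>\<^bsub>group_algebra (G \<times>\<times> G \<times>\<times> G) :: ('k, 'g \<times> 'g \<times> 'g \<Rightarrow> 'k) module\<^esub> comult_id G F =
     one_tensor G F \<otimes>\<^bsub>group_algebra (G \<times>\<times> G \<times>\<times> G) :: ('k, 'g \<times> 'g \<times> 'g \<Rightarrow> 'k) module\<^esub> id_comult G F"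

definition invariant_twist :: "('g, 'm) monoid_scheme \<Rightarrow> ('g \<times> 'g \<Rightarrow> 'k::field) \<Rightarrow> bool" where
  "invariant_twist G F \<longleftrightarrow>
     drinfeld_twist G F \<and>
     (\<forall>a \<in> carrier (group_algebra G :: ('k, 'g \<Rightarrow> 'k) module).
        comult G a \<otimes>\<^bsub>group_algebra (G \<times>\<times> G) :: ('k, 'g \<times> 'g \<Rightarrow> 'k) module\<^esub> F =
        F \<otimes>\<^bsub>group_algebra (G \<times>\<times> G) :: ('k, 'g \<times> 'g \<Rightarrow> 'k) module\<^esub> comult G a)"


section \<open>The character group and the two-cocycle of a twist\<close>

definition has_exponent :: "('g, 'm) monoid_scheme \<Rightarrow> nat \<Rightarrow> bool" where
  "has_exponent H N \<longleftrightarrow>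
     0 < N \<and> (\<forall>v\<in>carrier H. v [^]\<^bsub>H\<^esub> N = \<one>\<^bsub>H\<^esub>) \<and>
     (\<forall>m. 0 < m \<and> (\<forall>v\<in>carrier H. v [^]\<^bsub>H\<^esub> m = \<one>\<^bsub>H\<^esub>) \<longrightarrow> N \<le> m)"

definition primitive_root_of_unity :: "nat \<Rightarrow> 'k::field \<Rightarrow> bool" where
  "primitive_root_of_unity N \<zeta> \<longleftrightarrow> \<zeta> ^ N = 1 \<and> (\<forall>m. 0 < m \<and> m < N \<longrightarrow> \<zeta> ^ m \<noteq> 1)"

text \<open>
  Characters are extensional functions on the group, so that distinct elements of the
  carrier are distinct characters.
\<close>

definition char_group :: "('g, 'm) monoid_scheme \<Rightarrow> ('g \<Rightarrow> 'k::field) monoid" where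
  "char_group H =
     \<lparr>carrier = hom H (units_of scalar_ring) \<inter> extensional (carrier H),
      mult = (\<lambda>\<chi> \<psi>. \<lambda>v\<in>carrier H. \<chi> v * \<psi> v),
      one = (\<lambda>v\<in>carrier H. 1)\<rparr>"

definition char_idem :: "('g, 'm) monoid_scheme \<Rightarrow> ('g \<Rightarrow> 'k::field) \<Rightarrow> 'g \<Rightarrow> 'k" where
  "char_idem H \<chi> = (\<lambda>v. if v \<in> carrier H then inverse (of_nat (card (carrier H))) * inverse (\<chi> v) else 0)"

definition twist_cocycle ::
    "('g, 'm) monoid_scheme \<Rightarrow> ('g \<times> 'g \<Rightarrow> 'k::field) \<Rightarrow>
      (('g \<Rightarrow> 'k) \<Rightarrow> ('g \<Rightarrow> 'k) \<Rightarrow> 'k) \<Rightarrow> bool" where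
  "twist_cocycle H F \<sigma> \<longleftrightarrow>
     F = (\<lambda>(g, h). \<Sum>\<chi>\<in>carrier (char_group H). \<Sum>\<psi>\<in>carrier (char_group H).
            \<sigma> \<chi> \<psi> * (char_idem H \<chi> g * char_idem H \<psi> h))"

definition cocycle_b :: "('c \<Rightarrow> 'c \<Rightarrow> 'k::field) \<Rightarrow> 'c \<Rightarrow> 'c \<Rightarrow> 'k" where
  "cocycle_b \<sigma> \<chi> \<psi> = \<sigma> \<psi> \<chi> / \<sigma> \<chi> \<psi>"


section \<open>The twisted algebra and the map on relators\<close>

text \<open>\<open>V\<close> is the group (with its own carrier) whose characters are the arguments of \<open>\<sigma>\<close>.\<close>

definition twisted_algebra ::
    "('g, 'n) monoid_scheme \<Rightarrow> ('g, 'l) monoid_scheme \<Rightarrow> ('g \<times> 'g \<Rightarrow> 'k::field) \<Rightarrow>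
      (('g \<Rightarrow> 'k) \<Rightarrow> ('g \<Rightarrow> 'k) \<Rightarrow> 'k) \<Rightarrow> ('a \<Rightarrow> 'g \<Rightarrow> 'a) \<Rightarrow>
      ('k, 'a, 'm) module_scheme \<Rightarrow> ('k, 'a, 'm) module_scheme" where
  "twisted_algebra G V F \<sigma> act A = A
     \<lparr>mult := (\<lambda>a b. \<Oplus>\<^bsub>A\<^esub>t \<in> carrier (G \<times>\<times> G). F t \<odot>\<^bsub>A\<^esub> (act a (fst t) \<otimes>\<^bsub>A\<^esub> act b (snd t))),
      one := inverse (\<sigma> \<one>\<^bsub>char_group V\<^esub> \<one>\<^bsub>char_group V\<^esub>) \<odot>\<^bsub>A\<^esub> \<one>\<^bsub>A\<^esub>\<rparr>"

text \<open>The product of the \<open>\<chi> j\<close> over the letters \<open>j\<close> of a word.\<close>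

definition word_char ::
    "('g, 'm) monoid_scheme \<Rightarrow> (nat \<Rightarrow> 'g \<Rightarrow> 'k::field) \<Rightarrow> nat list \<Rightarrow> 'g \<Rightarrow> 'k" where
  "word_char V \<chi> w = foldr (\<lambda>j c. \<chi> j \<otimes>\<^bsub>char_group V\<^esub> c) w \<one>\<^bsub>char_group V\<^esub>"

text \<open>For words of length 1 the product is empty, hence the coefficient is 1.\<close>

definition kappa_coeff ::
    "('g, 'm) monoid_scheme \<Rightarrow> (('g \<Rightarrow> 'k::field) \<Rightarrow> ('g \<Rightarrow> 'k) \<Rightarrow> 'k) \<Rightarrow>
      (nat \<Rightarrow> 'g \<Rightarrow> 'k) \<Rightarrow> nat list \<Rightarrow> 'k" where
  "kappa_coeff V \<sigma> \<chi> w =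
     (if w = [] then \<sigma> \<one>\<^bsub>char_group V\<^esub> \<one>\<^bsub>char_group V\<^esub>
      else \<Prod>s\<in>{1..<length w}. inverse (\<sigma> (word_char V \<chi> (take s w)) (\<chi> (w ! s))))"

definition kappa ::
    "('g, 'm) monoid_scheme \<Rightarrow> (('g \<Rightarrow> 'k::field) \<Rightarrow> ('g \<Rightarrow> 'k) \<Rightarrow> 'k) \<Rightarrow>
      (nat \<Rightarrow> 'g \<Rightarrow> 'k) \<Rightarrow> (nat list \<Rightarrow> 'k) \<Rightarrow> nat list \<Rightarrow> 'k" where
  "kappa V \<sigma> \<chi> f = (\<lambda>w. kappa_coeff V \<sigma> \<chi> w * f w)"

end

theory Submission
  imports Defs
begin

text \<open>
  A word \<open>x\<^sub>i\<^sub>1 \<cdots> x\<^sub>i\<^sub>r\<close> is an eigenvector of \<open>V\<close>, its character being the product of the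
  \<open>\<chi>\<^sub>i\<close> over its letters, and on eigenvectors of characters \<open>\<phi>\<close> and \<open>\<psi>\<close> the twisted product is
  \<open>a *\<^sub>F b = \<sigma>(\<phi>, \<psi>) a b\<close> (\<open>sigma_eval\<close>, \<open>twisted_mult_image\<close>).  Multiplying out
  \<open>X\<^sub>i\<^sub>1 *\<^sub>F \<cdots> *\<^sub>F X\<^sub>i\<^sub>r\<close> letter by letter therefore gives the word itself times the inverse of its
  coefficient under \<open>\<kappa>\<close>.  So, for the projection \<open>\<pi>\<close> from the free algebra to \<open>A\<close>, the map
  \<open>\<rho> = \<pi> \<circ> \<kappa>\<inverse>\<close> should be the homomorphism to \<open>A\<^sub>F\<close> that sends each generator to \<open>X\<^sub>j\<close>.
  Its multiplicativity is the identity
  \<open>\<kappa>\<^sub>u \<kappa>\<^sub>v = \<kappa>\<^sub>u\<^sub>v \<sigma>(\<phi>\<^sub>u, \<phi>\<^sub>v)\<close> for words \<open>u\<close>, \<open>v\<close> with characters \<open>\<phi>\<^sub>u\<close>, \<open>\<phi>\<^sub>v\<close>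
  (\<open>kappa_coeff_append\<close>), an induction on \<open>v\<close> by the two-cocycle identity for \<open>\<sigma>\<close>, which is the
  twist equation evaluated at a triple of characters (\<open>sigma_cocycle\<close>).

  Since \<open>\<rho>\<close> is onto, \<open>A\<^sub>F\<close> inherits the laws of an algebra from the free algebra, and what remains is
  the kernel of \<open>\<rho>\<close>, which is \<open>\<kappa>(J)\<close> for the ideal \<open>J\<close> generated by the relators \<open>p\<^sub>i\<close>.  As a kernel it
  is an ideal, and it contains every \<open>\<kappa>(p\<^sub>i)\<close>.  It is no larger than the ideal \<open>L\<close> that they
  generate (\<open>kappa_genideal\<close>), and here the stability of the span of the relators under \<open>V\<close>
  enters: by Fourier inversion on \<open>V\<close> the span contains the homogeneous components of each relator,
  and on homogeneous elements \<open>\<kappa>\<close> is multiplicative up to nonzero scalars.  Consequently the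
  elements all of whose components are mapped into \<open>L\<close> by \<open>\<kappa>\<close> form an ideal that contains the
  relators.

  Finally \<open>X\<^sub>i *\<^sub>F X\<^sub>j = \<sigma>(\<chi>\<^sub>i, \<chi>\<^sub>j) x\<^sub>i x\<^sub>j\<close>, so a commutation relation in \<open>A\<close> turns into one in
  \<open>A\<^sub>F\<close> with the quotient of the two values of \<open>\<sigma>\<close> as a factor.
\<close>

section \<open>Associative algebras and their homomorphisms\<close>

definition alg_hom ::
    "('k::field, 'a, 'm) module_scheme \<Rightarrow> ('k, 'b, 'n) module_scheme \<Rightarrow> ('a \<Rightarrow> 'b) set" where
  "alg_hom A B = {h \<in> ring_hom A B. \<forall>c. \<forall>a\<in>carrier A. h (c \<odot>\<^bsub>A\<^esub> a) = c \<odot>\<^bsub>B\<^esub> h a}"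

lemma alg_homI:
  fixes A :: "('k::field, 'a, 'm) module_scheme" and B :: "('k, 'b, 'n) module_scheme"
  assumes "\<And>a. a \<in> carrier A \<Longrightarrow> h a \<in> carrier B"
    and "\<And>a b. \<lbrakk>a \<in> carrier A; b \<in> carrier A\<rbrakk> \<Longrightarrow> h (a \<otimes>\<^bsub>A\<^esub> b) = h a \<otimes>\<^bsub>B\<^esub> h b"
    and "\<And>a b. \<lbrakk>a \<in> carrier A; b \<in> carrier A\<rbrakk> \<Longrightarrow> h (a \<oplus>\<^bsub>A\<^esub> b) = h a \<oplus>\<^bsub>B\<^esub> h b"
    and "h \<one>\<^bsub>A\<^esub> = \<one>\<^bsub>B\<^esub>"
    and "\<And>c a. a \<in> carrier A \<Longrightarrow> h (c \<odot>\<^bsub>A\<^esub> a) = c \<odot>\<^bsub>B\<^esub> h a"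
  shows "h \<in> alg_hom A B"
  using assms by (auto simp: alg_hom_def ring_hom_def)

lemma alg_homD:
  fixes A :: "('k::field, 'a, 'm) module_scheme" and B :: "('k, 'b, 'n) module_scheme"
  assumes "h \<in> alg_hom A B"
  shows alg_hom_closed: "\<And>a. a \<in> carrier A \<Longrightarrow> h a \<in> carrier B"
    and alg_hom_mult: "\<And>a b. \<lbrakk>a \<in> carrier A; b \<in> carrier A\<rbrakk> \<Longrightarrow> h (a \<otimes>\<^bsub>A\<^esub> b) = h a \<otimes>\<^bsub>B\<^esub> h b"
    and alg_hom_add: "\<And>a b. \<lbrakk>a \<in> carrier A; b \<in> carrier A\<rbrakk> \<Longrightarrow> h (a \<oplus>\<^bsub>A\<^esub> b) = h a \<oplus>\<^bsub>B\<^esub> h b"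
    and alg_hom_one: "h \<one>\<^bsub>A\<^esub> = \<one>\<^bsub>B\<^esub>"
    and alg_hom_smult: "\<And>c a. a \<in> carrier A \<Longrightarrow> h (c \<odot>\<^bsub>A\<^esub> a) = c \<odot>\<^bsub>B\<^esub> h a"
    and alg_hom_ring_hom: "h \<in> ring_hom A B"
  using assms by (auto simp: alg_hom_def ring_hom_def)

lemma alg_iso_alg_hom: "h \<in> alg_iso A B \<Longrightarrow> h \<in> alg_hom A B"
  by (auto simp: alg_iso_def alg_hom_def ring_iso_def)

lemma alg_hom_compose:
  assumes "g \<in> alg_hom A B" and "h \<in> alg_hom B C"
  shows "(\<lambda>a. h (g a)) \<in> alg_hom A C"
  using assms by (intro alg_homI) (simp_all add: alg_homD)

lemma scalar_ring_simps [simp]: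
  "carrier scalar_ring = UNIV" "a \<otimes>\<^bsub>scalar_ring\<^esub> b = a * b" "a \<oplus>\<^bsub>scalar_ring\<^esub> b = a + b"
  "\<one>\<^bsub>scalar_ring\<^esub> = 1" "\<zero>\<^bsub>scalar_ring\<^esub> = 0"
  by (auto simp: scalar_ring_def)

lemma cring_scalar_ring: "cring (scalar_ring :: 'k::field ring)"
proof (rule cringI)
  show "abelian_group (scalar_ring :: 'k ring)"
    by (rule abelian_groupI) (auto simp: algebra_simps intro: exI[of _ "- x" for x])
  show "Group.comm_monoid (scalar_ring :: 'k ring)"
    by (rule comm_monoidI) (auto simp: algebra_simps)
qed (auto simp: algebra_simps)

lemma (in assoc_algebra) smult_closed': "a \<in> carrier A \<Longrightarrow> c \<odot>\<^bsub>A\<^esub> a \<in> carrier A"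
  by simp

lemma (in assoc_algebra) smult_zero: "a \<in> carrier A \<Longrightarrow> 0 \<odot>\<^bsub>A\<^esub> a = \<zero>\<^bsub>A\<^esub>"
  using smult_l_null[of a] by simp

lemma assoc_algebraI:
  fixes A :: "('k::field, 'a, 'm) module_scheme"
  assumes "ring A"
    and "\<And>c a. a \<in> carrier A \<Longrightarrow> c \<odot>\<^bsub>A\<^esub> a \<in> carrier A"
    and "\<And>c d a. a \<in> carrier A \<Longrightarrow> (c + d) \<odot>\<^bsub>A\<^esub> a = c \<odot>\<^bsub>A\<^esub> a \<oplus>\<^bsub>A\<^esub> d \<odot>\<^bsub>A\<^esub> a"
    and "\<And>c a b. \<lbrakk>a \<in> carrier A; b \<in> carrier A\<rbrakk> \<Longrightarrow>
      c \<odot>\<^bsub>A\<^esub> (a \<oplus>\<^bsub>A\<^esub> b) = c \<odot>\<^bsub>A\<^esub> a \<oplus>\<^bsub>A\<^esub> c \<odot>\<^bsub>A\<^esub> b"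
    and "\<And>c d a. a \<in> carrier A \<Longrightarrow> (c * d) \<odot>\<^bsub>A\<^esub> a = c \<odot>\<^bsub>A\<^esub> (d \<odot>\<^bsub>A\<^esub> a)"
    and "\<And>a. a \<in> carrier A \<Longrightarrow> 1 \<odot>\<^bsub>A\<^esub> a = a"
    and "\<And>c a b. \<lbrakk>a \<in> carrier A; b \<in> carrier A\<rbrakk> \<Longrightarrow>
      (c \<odot>\<^bsub>A\<^esub> a) \<otimes>\<^bsub>A\<^esub> b = c \<odot>\<^bsub>A\<^esub> (a \<otimes>\<^bsub>A\<^esub> b)"
    and "\<And>c a b. \<lbrakk>a \<in> carrier A; b \<in> carrier A\<rbrakk> \<Longrightarrow>
      a \<otimes>\<^bsub>A\<^esub> (c \<odot>\<^bsub>A\<^esub> b) = c \<odot>\<^bsub>A\<^esub> (a \<otimes>\<^bsub>A\<^esub> b)"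
  shows "assoc_algebra A"
proof (intro assoc_algebra.intro assoc_algebra_axioms.intro)
  show "module (scalar_ring :: 'k ring) A"
    using assms ring.is_abelian_group[OF assms(1)] by (intro moduleI cring_scalar_ring) auto
qed (use assms in auto)

lemma (in assoc_algebra) submodule_fromI:
  assumes "S \<subseteq> carrier A" and "\<zero>\<^bsub>A\<^esub> \<in> S"
    and "\<And>a b. \<lbrakk>a \<in> S; b \<in> S\<rbrakk> \<Longrightarrow> a \<oplus>\<^bsub>A\<^esub> b \<in> S"
    and "\<And>c a. a \<in> S \<Longrightarrow> c \<odot>\<^bsub>A\<^esub> a \<in> S"
  shows "submodule S (scalar_ring :: 'k ring) A"
proof (rule submoduleI)
  fix a assume "a \<in> S"
  then have "\<ominus>\<^bsub>A\<^esub> a = (\<ominus>\<^bsub>scalar_ring\<^esub> \<one>\<^bsub>scalar_ring\<^esub>) \<odot>\<^bsub>A\<^esub> a"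
    using assms(1) smult_l_minus[of "\<one>\<^bsub>scalar_ring\<^esub>" a] smult_one[of a] by auto
  then show "\<ominus>\<^bsub>A\<^esub> a \<in> S" using assms(4)[OF \<open>a \<in> S\<close>] by simp
qed (use assms in auto)

lemma (in assoc_algebra) ideal_fromI:
  assumes "S \<subseteq> carrier A" and "\<zero>\<^bsub>A\<^esub> \<in> S"
    and "\<And>a b. \<lbrakk>a \<in> S; b \<in> S\<rbrakk> \<Longrightarrow> a \<oplus>\<^bsub>A\<^esub> b \<in> S"
    and "\<And>c a. a \<in> S \<Longrightarrow> c \<odot>\<^bsub>A\<^esub> a \<in> S"
    and "\<And>a b. \<lbrakk>a \<in> S; b \<in> carrier A\<rbrakk> \<Longrightarrow> b \<otimes>\<^bsub>A\<^esub> a \<in> S"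
    and "\<And>a b. \<lbrakk>a \<in> S; b \<in> carrier A\<rbrakk> \<Longrightarrow> a \<otimes>\<^bsub>A\<^esub> b \<in> S"
  shows "ideal S A"
proof -
  have "submodule S (scalar_ring :: 'k ring) A"
    using assms(1-4) by (rule submodule_fromI)
  then have "subgroup S (add_monoid A)" by (rule submodule.axioms)
  then show ?thesis using assms(5,6) ring_axioms by (intro idealI)
qed

lemma (in assoc_algebra) ideal_smult_closed:
  assumes "ideal J A" and "a \<in> J"
  shows "c \<odot>\<^bsub>A\<^esub> a \<in> J"
proof -
  interpret J: ideal J A by fact
  have "c \<odot>\<^bsub>A\<^esub> a = (c \<odot>\<^bsub>A\<^esub> \<one>\<^bsub>A\<^esub>) \<otimes>\<^bsub>A\<^esub> a"
    using J.Icarr[OF assms(2)] by (simp add: smult_mult_left)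
  then show ?thesis
    using J.I_l_closed[OF assms(2), of "c \<odot>\<^bsub>A\<^esub> \<one>\<^bsub>A\<^esub>"] by simp
qed

lemma (in assoc_algebra) scalar_laws:
  "a \<in> carrier A \<Longrightarrow> (c + d) \<odot>\<^bsub>A\<^esub> a = c \<odot>\<^bsub>A\<^esub> a \<oplus>\<^bsub>A\<^esub> d \<odot>\<^bsub>A\<^esub> a"
  "\<lbrakk>a \<in> carrier A; b \<in> carrier A\<rbrakk> \<Longrightarrow>
    c \<odot>\<^bsub>A\<^esub> (a \<oplus>\<^bsub>A\<^esub> b) = c \<odot>\<^bsub>A\<^esub> a \<oplus>\<^bsub>A\<^esub> c \<odot>\<^bsub>A\<^esub> b"
  "a \<in> carrier A \<Longrightarrow> (c * d) \<odot>\<^bsub>A\<^esub> a = c \<odot>\<^bsub>A\<^esub> (d \<odot>\<^bsub>A\<^esub> a)"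
  "a \<in> carrier A \<Longrightarrow> 1 \<odot>\<^bsub>A\<^esub> a = a"
     apply (use smult_l_distr[of c d a] in simp)
    apply (use smult_r_distr[of c a b] in simp)
   apply (use smult_assoc1[of c d a] in simp)
  apply (use smult_one[of a] in simp)
  done

text \<open>
  The laws of an algebra pass to the image of a homomorphism, even if the target is so far only a set
  with operations.  For the twisted product this replaces a separate proof of associativity.
\<close>

lemma assoc_algebra_surj_image:
  fixes B :: "('k::field, 'b, 'n) module_scheme"
  assumes A: "assoc_algebra A" and h: "h \<in> alg_hom A B"
    and surj: "h ` carrier A = carrier B" and zero: "h \<zero>\<^bsub>A\<^esub> = \<zero>\<^bsub>B\<^esub>"
  shows "assoc_algebra B"
proof -
  interpret A: assoc_algebra A by fact
  note hs = alg_hom_mult[OF h, symmetric] alg_hom_add[OF h, symmetric] alg_hom_smult[OF h, symmetric]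
  have "ring (B\<lparr>carrier := h ` carrier A, zero := h \<zero>\<^bsub>A\<^esub>\<rparr>)"
    by (rule A.ring_hom_imp_img_ring[OF alg_hom_ring_hom[OF h]])
  then have ring: "ring B" by (simp add: surj zero)
  have pre: "\<exists>a\<in>carrier A. b = h a" if "b \<in> carrier B" for b
    using that unfolding surj[symmetric] by (rule imageE) (rule bexI)
  show ?thesis
  proof (rule assoc_algebraI[OF ring])
    fix c b assume "b \<in> carrier B"
    then obtain b' where "b' \<in> carrier A" "b = h b'"
      using pre by blast
    then show "c \<odot>\<^bsub>B\<^esub> b \<in> carrier B"
      by (simp add: hs alg_hom_closed[OF h] )
  next
    fix c d b assume "b \<in> carrier B"
    then obtain b' where "b' \<in> carrier A" "b = h b'"
      using pre by blast
    then show "(c + d) \<odot>\<^bsub>B\<^esub> b = c \<odot>\<^bsub>B\<^esub> b \<oplus>\<^bsub>B\<^esub> d \<odot>\<^bsub>B\<^esub> b"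
      by (simp add: hs alg_hom_closed[OF h] A.scalar_laws)
  next
    fix c a b assume "a \<in> carrier B" "b \<in> carrier B"
    then obtain a' b' where "a' \<in> carrier A" "b' \<in> carrier A" "a = h a'" "b = h b'"
      by (elim pre[THEN bexE]) (rule that)
    then show "c \<odot>\<^bsub>B\<^esub> (a \<oplus>\<^bsub>B\<^esub> b) = c \<odot>\<^bsub>B\<^esub> a \<oplus>\<^bsub>B\<^esub> c \<odot>\<^bsub>B\<^esub> b"
      by (simp add: hs A.scalar_laws)
  next
    fix c d b assume "b \<in> carrier B"
    then obtain b' where "b' \<in> carrier A" "b = h b'"
      using pre by blast
    then show "(c * d) \<odot>\<^bsub>B\<^esub> b = c \<odot>\<^bsub>B\<^esub> (d \<odot>\<^bsub>B\<^esub> b)"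
      by (simp add: hs alg_hom_closed[OF h] A.scalar_laws)
  next
    fix b assume "b \<in> carrier B"
    then obtain b' where "b' \<in> carrier A" "b = h b'"
      using pre by blast
    then show "1 \<odot>\<^bsub>B\<^esub> b = b"
      by (simp add: hs alg_hom_closed[OF h] A.scalar_laws)
  next
    fix c a b assume "a \<in> carrier B" "b \<in> carrier B"
    then obtain a' b' where "a' \<in> carrier A" "b' \<in> carrier A" "a = h a'" "b = h b'"
      by (elim pre[THEN bexE]) (rule that)
    then show "(c \<odot>\<^bsub>B\<^esub> a) \<otimes>\<^bsub>B\<^esub> b = c \<odot>\<^bsub>B\<^esub> (a \<otimes>\<^bsub>B\<^esub> b)"
      by (simp add: hs A.smult_mult_left)
  next
    fix c a b assume "a \<in> carrier B" "b \<in> carrier B"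
    then obtain a' b' where "a' \<in> carrier A" "b' \<in> carrier A" "a = h a'" "b = h b'"
      by (elim pre[THEN bexE]) (rule that)
    then show "a \<otimes>\<^bsub>B\<^esub> (c \<odot>\<^bsub>B\<^esub> b) = c \<odot>\<^bsub>B\<^esub> (a \<otimes>\<^bsub>B\<^esub> b)"
      by (simp add: hs A.smult_mult_right)
  qed
qed

lemma alg_hom_zero:
  assumes "assoc_algebra A" and "assoc_algebra B" and "h \<in> alg_hom A B"
  shows "h \<zero>\<^bsub>A\<^esub> = \<zero>\<^bsub>B\<^esub>"
proof -
  interpret A: assoc_algebra A by fact
  interpret B: assoc_algebra B by fact
  show ?thesis
    using ring_hom_zero[OF alg_hom_ring_hom[OF assms(3)] A.ring_axioms B.ring_axioms] .
qed

section \<open>Free algebras\<close>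

abbreviation letters_in :: "nat \<Rightarrow> nat list \<Rightarrow> bool" where
  "letters_in n w \<equiv> set w \<subseteq> {1..n}"

definition free_word :: "nat list \<Rightarrow> nat list \<Rightarrow> 'k::field" where
  "free_word u = (\<lambda>w. if w = u then 1 else 0)"

lemma free_algebra_simps [simp]:
  "f \<otimes>\<^bsub>free_algebra n\<^esub> g = (\<lambda>w. \<Sum>i\<le>length w. f (take i w) * g (drop i w))"
  "\<one>\<^bsub>free_algebra n\<^esub> = free_word []"
  "\<zero>\<^bsub>free_algebra n\<^esub> = (\<lambda>w. 0)"
  "f \<oplus>\<^bsub>free_algebra n\<^esub> g = (\<lambda>w. f w + g w)"
  "c \<odot>\<^bsub>free_algebra n\<^esub> f = (\<lambda>w. c * f w)"
  by (auto simp: free_algebra_def free_word_def)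

lemma free_algebra_carrier:
  "f \<in> carrier (free_algebra n) \<longleftrightarrow> finite {w. f w \<noteq> 0} \<and> (\<forall>w. f w \<noteq> 0 \<longrightarrow> letters_in n w)"
  by (auto simp: free_algebra_def)

lemma free_algebra_carrierI:
  assumes "f \<in> carrier (free_algebra n)" and "\<And>w. g w \<noteq> 0 \<Longrightarrow> f w \<noteq> 0"
  shows "g \<in> carrier (free_algebra n)"
proof -
  have "finite {w. g w \<noteq> 0}"
    by (rule finite_subset[of _ "{w. f w \<noteq> 0}"]) (use assms in \<open>auto simp: free_algebra_carrier\<close>)
  then show ?thesis using assms by (auto simp: free_algebra_carrier)
qed

lemma free_word_closed [simp]: "letters_in n u \<Longrightarrow> free_word u \<in> carrier (free_algebra n)"
  by (auto simp: free_algebra_carrier free_word_def)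

lemma free_gen_eq_word: "free_gen j = free_word [j]"
  by (simp add: free_gen_def free_word_def)

lemma free_gen_closed [simp]: "j \<in> {1..n} \<Longrightarrow> free_gen j \<in> carrier (free_algebra n)"
  by (simp add: free_gen_eq_word)

lemma free_algebra_mult_closed:
  assumes "f \<in> carrier (free_algebra n)" and "g \<in> carrier (free_algebra n)"
  shows "(\<lambda>w. \<Sum>i\<le>length w. c (take i w) (drop i w) * (f (take i w) * g (drop i w)))
    \<in> carrier (free_algebra n)"
proof -
  let ?h = "\<lambda>w. \<Sum>i\<le>length w. c (take i w) (drop i w) * (f (take i w) * g (drop i w))"
  have split: "\<exists>u v. w = u @ v \<and> f u \<noteq> 0 \<and> g v \<noteq> 0" if "?h w \<noteq> 0" for w
  proof -
    from that obtain i where "c (take i w) (drop i w) * (f (take i w) * g (drop i w)) \<noteq> 0"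
      by (meson sum.not_neutral_contains_not_neutral)
    then show ?thesis by (intro exI[of _ "take i w"] exI[of _ "drop i w"]) auto
  qed
  have "{w. ?h w \<noteq> 0} \<subseteq> (\<lambda>(u, v). u @ v) ` ({u. f u \<noteq> 0} \<times> {v. g v \<noteq> 0})"
    using split by fastforce
  then have "finite {w. ?h w \<noteq> 0}"
    by (rule finite_subset) (use assms in \<open>auto simp: free_algebra_carrier\<close>)
  moreover have "letters_in n w" if "?h w \<noteq> 0" for w
    using split[OF that] assms by (fastforce simp: free_algebra_carrier)
  ultimately show ?thesis by (simp add: free_algebra_carrier)
qed

text \<open>Splitting off the first letter reduces associativity to an induction on words.\<close>

lemma free_mult_Cons:
  fixes f g :: "nat list \<Rightarrow> 'k::field"
  shows "(\<Sum>i\<le>length (a # w). f (take i (a # w)) * g (drop i (a # w))) =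
    f [] * g (a # w) + (\<Sum>i\<le>length w. f (a # take i w) * g (drop i w))"
  by (simp add: sum.atMost_Suc_shift del: sum.atMost_Suc)

lemma free_mult_assoc:
  fixes f g h :: "nat list \<Rightarrow> 'k::field"
  shows "(\<Sum>i\<le>length w. (\<Sum>j\<le>length (take i w). f (take j (take i w)) * g (drop j (take i w))) * h (drop i w))
    = (\<Sum>i\<le>length w. f (take i w) *
        (\<Sum>j\<le>length (drop i w). g (take j (drop i w)) * h (drop j (drop i w))))"
proof (induction w arbitrary: f)
  case Nil
  then show ?case by (simp add: mult.assoc)
next
  case (Cons a w)
  define m where "m = (\<lambda>(p :: nat list \<Rightarrow> 'k) q (w :: nat list). \<Sum>i\<le>length w. p (take i w) * q (drop i w))"
  have m_Nil: "m p q [] = p [] * q []" for p q by (simp add: m_def)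
  have m_Cons: "m p q (b # v) = p [] * q (b # v) + m (\<lambda>v. p (b # v)) q v" for p q b v
    unfolding m_def by (rule free_mult_Cons)
  have m_lin: "m (\<lambda>v. c * p v + q v) h v = c * m p h v + m q h v" for c p q v
    by (simp add: m_def algebra_simps sum.distrib sum_distrib_left)
  have IH: "m (m p g) h w = m p (m g h) w" for p
    using Cons.IH[of p] by (simp add: m_def)
  have "m (m f g) h (a # w) = m f (m g h) (a # w)"
    by (simp add: m_Cons m_Nil m_lin IH algebra_simps)
  then show ?case by (simp add: m_def)
qed

lemma free_word_mult:
  "letters_in n u \<Longrightarrow> free_word [j] \<otimes>\<^bsub>free_algebra n :: ('k::field, nat list \<Rightarrow> 'k) module\<^esub> free_word u = free_word (j # u)"
proof
  fix w
  show "(free_word [j] \<otimes>\<^bsub>free_algebra n :: ('k, nat list \<Rightarrow> 'k) module\<^esub> free_word u) w = free_word (j # u) w"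
  proof (cases w)
    case (Cons a v)
    have "(\<Sum>i\<le>length v. (if a = j \<and> take i v = [] then 1 else 0) * (if drop i v = u then 1 else (0::'k)))
      = (\<Sum>i\<in>{0}. (if a = j \<and> take i v = [] then 1 else 0) * (if drop i v = u then 1 else 0))"
      by (rule sum.mono_neutral_right) auto
    then show ?thesis
      unfolding Cons free_algebra_simps free_mult_Cons by (simp add: free_word_def)
  qed (simp add: free_word_def)
qed

lemma free_algebra_assoc_algebra: "assoc_algebra (free_algebra n :: ('k::field, nat list \<Rightarrow> 'k) module)"
proof (rule assoc_algebraI)
  let ?R = "free_algebra n :: ('k, nat list \<Rightarrow> 'k) module"
  have zero: "(\<lambda>w. 0) \<in> carrier ?R"
    by (simp add: free_algebra_carrier)
  have add: "(\<lambda>w. f w + g w) \<in> carrier ?R" if "f \<in> carrier ?R" "g \<in> carrier ?R" for f g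
  proof -
    have "finite {w. f w + g w \<noteq> 0}"
      by (rule finite_subset[of _ "{w. f w \<noteq> 0} \<union> {w. g w \<noteq> 0}"])
        (use that in \<open>auto simp: free_algebra_carrier\<close>)
    moreover have "letters_in n w" if "f w + g w \<noteq> 0" for w
    proof -
      from that have "f w \<noteq> 0 \<or> g w \<noteq> 0" by auto
      then show ?thesis using \<open>f \<in> carrier ?R\<close> \<open>g \<in> carrier ?R\<close> unfolding free_algebra_carrier by blast
    qed
    ultimately show ?thesis by (simp add: free_algebra_carrier)
  qed
  have smult: "(\<lambda>w. c * f w) \<in> carrier ?R" if "f \<in> carrier ?R" for f c
    by (rule free_algebra_carrierI[OF that]) auto
  have mult: "(\<lambda>w. \<Sum>i\<le>length w. f (take i w) * g (drop i w)) \<in> carrier ?R"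
    if "f \<in> carrier ?R" "g \<in> carrier ?R" for f g
    using free_algebra_mult_closed[OF that, of "\<lambda>_ _. 1"] by simp
  show "ring ?R"
  proof (rule ringI)
    show "abelian_group ?R"
    proof (rule abelian_groupI)
      fix f assume "f \<in> carrier ?R"
      then show "\<exists>g\<in>carrier ?R. g \<oplus>\<^bsub>?R\<^esub> f = \<zero>\<^bsub>?R\<^esub>"
        using smult[of f "-1"] by (intro bexI[of _ "\<lambda>w. -1 * f w"]) auto
    qed (auto simp: zero add algebra_simps)
    show "Group.monoid ?R"
    proof (rule monoidI)
      fix f assume "f \<in> carrier ?R"
      show "\<one>\<^bsub>?R\<^esub> \<otimes>\<^bsub>?R\<^esub> f = f"
      proof
        fix w
        have "(\<Sum>i\<le>length w. (if take i w = [] then 1 else 0) * f (drop i w))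
          = (\<Sum>i\<in>{0}. (if take i w = [] then 1 else 0) * f (drop i w))"
          by (rule sum.mono_neutral_right) auto
        then show "(\<one>\<^bsub>?R\<^esub> \<otimes>\<^bsub>?R\<^esub> f) w = f w"
          by (simp add: free_word_def)
      qed
      show "f \<otimes>\<^bsub>?R\<^esub> \<one>\<^bsub>?R\<^esub> = f"
      proof
        fix w
        have "(\<Sum>i\<le>length w. f (take i w) * (if drop i w = [] then 1 else 0))
          = (\<Sum>i\<in>{length w}. f (take i w) * (if drop i w = [] then 1 else 0))"
          by (rule sum.mono_neutral_right) auto
        then show "(f \<otimes>\<^bsub>?R\<^esub> \<one>\<^bsub>?R\<^esub>) w = f w"
          by (simp add: free_word_def)
      qed
    next
      fix f g h :: "nat list \<Rightarrow> 'k"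
      show "f \<otimes>\<^bsub>?R\<^esub> g \<otimes>\<^bsub>?R\<^esub> h = f \<otimes>\<^bsub>?R\<^esub> (g \<otimes>\<^bsub>?R\<^esub> h)"
        unfolding free_algebra_simps by (rule ext) (rule free_mult_assoc)
    qed (auto simp: mult)
  qed (auto simp: algebra_simps sum.distrib)
qed (auto simp: algebra_simps sum_distrib_left intro: free_algebra_carrierI)

lemma free_algebra_induct [consumes 1, case_names zero monomial add]:
  fixes f :: "nat list \<Rightarrow> 'k::field"
  assumes "f \<in> carrier (free_algebra n)"
    and zero: "P (\<lambda>w. 0)"
    and monomial: "\<And>c u. letters_in n u \<Longrightarrow> P (\<lambda>w. c * free_word u w)"
    and add: "\<And>f g. \<lbrakk>f \<in> carrier (free_algebra n); g \<in> carrier (free_algebra n); P f; P g\<rbrakk> \<Longrightarrow>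
      P (\<lambda>w. f w + g w)"
  shows "P f"
proof -
  have "finite S \<Longrightarrow> {w. f w \<noteq> 0} = S \<Longrightarrow> f \<in> carrier (free_algebra n) \<Longrightarrow> P f" for S f
  proof (induction S arbitrary: f rule: finite_induct)
    case empty
    then have "f = (\<lambda>w. 0)" by auto
    then show ?case using zero by simp
  next
    case (insert u S)
    let ?g = "f(u := 0)" and ?m = "\<lambda>w. f u * free_word u w"
    from insert.prems insert.hyps have "{w. ?g w \<noteq> 0} = S" by auto
    moreover have g: "?g \<in> carrier (free_algebra n)"
      by (rule free_algebra_carrierI[OF insert.prems(2)]) (auto split: if_splits)
    ultimately have "P ?g" by (rule insert.IH)
    have u: "letters_in n u" using insert.prems by (auto simp: free_algebra_carrier)
    have "?m \<in> carrier (free_algebra n)"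
      by (rule free_algebra_carrierI[OF free_word_closed[OF u]]) auto
    then have "P (\<lambda>w. ?g w + ?m w)"
      using g \<open>P ?g\<close> monomial[OF u] by (intro add)
    moreover have "(\<lambda>w. ?g w + ?m w) = f" by (auto simp: free_word_def)
    ultimately show ?case by simp
  qed
  then show ?thesis using assms(1) by (auto simp: free_algebra_carrier)
qed

text \<open>
  An action by automorphisms, followed or preceded by a homomorphism from the free algebra, is
  again such a homomorphism, and is therefore known once its values on the generators are.
\<close>

lemma free_algebra_hom_unique:
  fixes B :: "('k::field, 'b, 'n) module_scheme"
  assumes "assoc_algebra B"
    and g: "g \<in> alg_hom (free_algebra n) B" and h: "h \<in> alg_hom (free_algebra n) B"
    and gen: "\<And>j. j \<in> {1..n} \<Longrightarrow> g (free_gen j) = h (free_gen j)"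
    and f: "f \<in> carrier (free_algebra n)"
  shows "g f = h f"
proof -
  have word: "g (free_word u) = h (free_word u)" if "letters_in n u" for u
    using that
  proof (induction u)
    case Nil
    then show ?case using alg_hom_one[OF g] alg_hom_one[OF h] by simp
  next
    case (Cons j u)
    then show ?case
      using alg_hom_mult[OF g, of "free_word [j]" "free_word u"]
        alg_hom_mult[OF h, of "free_word [j]" "free_word u"] gen[of j]
      by (simp add: free_gen_eq_word free_word_mult del: free_algebra_simps)
  qed
  from f show ?thesis
  proof (induction rule: free_algebra_induct)
    case zero
    show ?case
      using alg_hom_zero[OF free_algebra_assoc_algebra assms(1) g]
        alg_hom_zero[OF free_algebra_assoc_algebra assms(1) h] by simp
  next
    case (monomial c u)
    then show ?case
      using alg_hom_smult[OF g, of "free_word u" c] alg_hom_smult[OF h, of "free_word u" c] word by simp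
  next
    case (add f1 f2)
    then show ?case
      using alg_hom_add[OF g, of f1 f2] alg_hom_add[OF h, of f1 f2] by simp
  qed
qed

lemma free_algebra_hom_sum:
  fixes B :: "('k::field, 'b, 'n) module_scheme"
  assumes B: "assoc_algebra B" and h: "h \<in> alg_hom (free_algebra n) B" and "finite T"
    and "\<And>t. t \<in> T \<Longrightarrow> f t \<in> carrier (free_algebra n)"
  shows "(\<lambda>w. \<Sum>t\<in>T. c t * f t w) \<in> carrier (free_algebra n)
    \<and> h (\<lambda>w. \<Sum>t\<in>T. c t * f t w) = (\<Oplus>\<^bsub>B\<^esub>t\<in>T. c t \<odot>\<^bsub>B\<^esub> h (f t))"
  using assms(3,4)
proof (induction T rule: finite_induct)
  case empty
  interpret B: assoc_algebra B by fact
  show ?case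
    using alg_hom_zero[OF free_algebra_assoc_algebra B h] by (simp add: free_algebra_carrier)
next
  case (insert t T)
  interpret B: assoc_algebra B by fact
  interpret R: assoc_algebra "free_algebra n :: ('k, nat list \<Rightarrow> 'k) module"
    by (rule free_algebra_assoc_algebra)
  let ?s = "\<lambda>w. \<Sum>t\<in>T. c t * f t w"
  have s: "?s \<in> carrier (free_algebra n)" "h ?s = (\<Oplus>\<^bsub>B\<^esub>t\<in>T. c t \<odot>\<^bsub>B\<^esub> h (f t))"
    using insert by auto
  have ft: "(\<lambda>w. c t * f t w) \<in> carrier (free_algebra n)"
    using R.smult_closed'[of "f t" "c t"] insert.prems by simp
  have sum: "(\<lambda>w. \<Sum>t\<in>insert t T. c t * f t w) = (\<lambda>w. c t * f t w + ?s w)"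
    using insert.hyps by simp
  have "h (\<lambda>w. c t * f t w + ?s w) = h (\<lambda>w. c t * f t w) \<oplus>\<^bsub>B\<^esub> h ?s"
    using alg_hom_add[OF h ft s(1)] by simp
  moreover have "h (\<lambda>w. c t * f t w) = c t \<odot>\<^bsub>B\<^esub> h (f t)"
    using alg_hom_smult[OF h, of "f t" "c t"] insert.prems by simp
  moreover have "(\<Oplus>\<^bsub>B\<^esub>t\<in>insert t T. c t \<odot>\<^bsub>B\<^esub> h (f t))
      = c t \<odot>\<^bsub>B\<^esub> h (f t) \<oplus>\<^bsub>B\<^esub> (\<Oplus>\<^bsub>B\<^esub>t\<in>T. c t \<odot>\<^bsub>B\<^esub> h (f t))"
    using insert alg_hom_closed[OF h] by (intro B.finsum_insert) auto
  ultimately show ?case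
    unfolding sum using s R.a_closed[OF ft s(1)] by simp
qed

lemma free_ideal_sum_closed:
  fixes h :: "'t \<Rightarrow> nat list \<Rightarrow> 'k::field"
  assumes "ideal L (free_algebra n :: ('k, nat list \<Rightarrow> 'k) module)" and "finite T" and "\<And>t. t \<in> T \<Longrightarrow> h t \<in> L"
  shows "(\<lambda>w. \<Sum>t\<in>T. h t w) \<in> L"
  using assms(2,3)
proof (induction T rule: finite_induct)
  case empty
  interpret L: ideal L "free_algebra n :: ('k, nat list \<Rightarrow> 'k) module" by fact
  show ?case using additive_subgroup.zero_closed[OF L.is_additive_subgroup] by simp
next
  case (insert t T)
  interpret L: ideal L "free_algebra n :: ('k, nat list \<Rightarrow> 'k) module" by fact
  show ?case using insert additive_subgroup.a_closed[OF L.is_additive_subgroup, of "h t" "\<lambda>w. \<Sum>t\<in>T. h t w"] by simp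
qed

text \<open>
  Identities between functions of words are available only for words over the alphabet; for products
  in the free algebra that is enough, because its elements vanish on all other words.
\<close>

lemma free_mult_cong:
  assumes "f \<in> carrier (free_algebra n)" and "g \<in> carrier (free_algebra n)"
    and "\<And>u v. \<lbrakk>letters_in n u; letters_in n v\<rbrakk> \<Longrightarrow> c u v = d u v"
  shows "(\<Sum>i\<le>length w. c (take i w) (drop i w) * (f (take i w) * g (drop i w))) =
    (\<Sum>i\<le>length w. d (take i w) (drop i w) * (f (take i w) * g (drop i w)))"
proof (rule sum.cong[OF refl])
  fix i
  show "c (take i w) (drop i w) * (f (take i w) * g (drop i w)) =
      d (take i w) (drop i w) * (f (take i w) * g (drop i w))"
    using assms by (cases "f (take i w) = 0 \<or> g (drop i w) = 0") (auto simp: free_algebra_carrier)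
qed

section \<open>Presentations as surjections with prescribed kernel\<close>

lemma quotient_algebra_smult:
  assumes "assoc_algebra A" and "ideal J A" and f: "f \<in> carrier A"
  shows "c \<odot>\<^bsub>quotient_algebra A J\<^esub> (J +>\<^bsub>A\<^esub> f) = J +>\<^bsub>A\<^esub> (c \<odot>\<^bsub>A\<^esub> f)"
proof -
  interpret A: assoc_algebra A by fact
  interpret J: ideal J A by fact
  have "J +>\<^bsub>A\<^esub> (c \<odot>\<^bsub>A\<^esub> a) = J +>\<^bsub>A\<^esub> (c \<odot>\<^bsub>A\<^esub> f)" if a: "a \<in> J +>\<^bsub>A\<^esub> f" for a
  proof -
    from a obtain j where j: "j \<in> J" "a = j \<oplus>\<^bsub>A\<^esub> f" by (auto simp: a_r_coset_def')
    have "c \<odot>\<^bsub>A\<^esub> a = c \<odot>\<^bsub>A\<^esub> j \<oplus>\<^bsub>A\<^esub> c \<odot>\<^bsub>A\<^esub> f"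
      using j f J.Icarr by (simp add: A.smult_r_distr)
    then have "c \<odot>\<^bsub>A\<^esub> a \<in> J +>\<^bsub>A\<^esub> (c \<odot>\<^bsub>A\<^esub> f)"
      using A.ideal_smult_closed[OF assms(2) j(1)] by (auto simp: a_r_coset_def')
    then show ?thesis using J.a_repr_independence' f by auto
  qed
  moreover have "f \<in> J +>\<^bsub>A\<^esub> f" using f by (rule J.a_rcos_self)
  ultimately have "(\<Union>a\<in>J +>\<^bsub>A\<^esub> f. J +>\<^bsub>A\<^esub> (c \<odot>\<^bsub>A\<^esub> a)) = J +>\<^bsub>A\<^esub> (c \<odot>\<^bsub>A\<^esub> f)" by blast
  then show ?thesis
    by (simp add: quotient_algebra_def ring.extend_def module.fields_def)
qed

lemma quotient_algebra_ring_iso: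
  "ring_iso (quotient_algebra A J) B = ring_iso (A Quot J) B"
  by (auto simp: ring_iso_def ring_hom_def quotient_algebra_def ring.extend_def module.fields_def)

lemma quotient_algebra_carrier: "carrier (quotient_algebra A J) = carrier (A Quot J)"
  by (simp add: quotient_algebra_def ring.extend_def module.fields_def)

text \<open>
  The first isomorphism theorem and its converse; presentations can then be given and used
  through homomorphisms on elements instead of cosets.
\<close>

lemma quotient_algebra_iso_iff:
  fixes R :: "('k::field, 'r, 'l) module_scheme" and A :: "('k, 'a, 'm) module_scheme"
  assumes R: "assoc_algebra R" and A: "assoc_algebra A" and J: "ideal J R"
    and g: "\<And>j. j \<in> T \<Longrightarrow> g j \<in> carrier R"
  shows "(\<exists>\<theta>\<in>alg_iso (quotient_algebra R J) A. \<forall>j\<in>T. \<theta> (J +>\<^bsub>R\<^esub> g j) = x j) \<longleftrightarrow>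
    (\<exists>\<pi>\<in>alg_hom R A. \<pi> ` carrier R = carrier A \<and> a_kernel R A \<pi> = J \<and> (\<forall>j\<in>T. \<pi> (g j) = x j))"
proof -
  interpret A: assoc_algebra A by fact
  interpret R: assoc_algebra R by fact
  interpret J: ideal J R by fact
  have "(\<exists>\<pi>\<in>alg_hom R A. \<pi> ` carrier R = carrier A \<and> a_kernel R A \<pi> = J \<and>
      (\<forall>j\<in>T. \<pi> (g j) = x j))"
    if "\<theta> \<in> alg_iso (quotient_algebra R J) A" and gen: "\<forall>j\<in>T. \<theta> (J +>\<^bsub>R\<^esub> g j) = x j" for \<theta>
  proof -
    have iso: "\<theta> \<in> ring_iso (R Quot J) A"
      using that(1) by (simp add: alg_iso_def quotient_algebra_ring_iso)
    have \<theta>_hom: "\<theta> \<in> ring_hom (R Quot J) A"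
      and \<theta>_bij: "bij_betw \<theta> (carrier (R Quot J)) (carrier A)"
      using iso by (auto simp: ring_iso_def)
    have \<theta>_smult: "\<theta> (c \<odot>\<^bsub>quotient_algebra R J\<^esub> C) = c \<odot>\<^bsub>A\<^esub> \<theta> C" if "C \<in> carrier (R Quot J)" for c C
      using that \<open>\<theta> \<in> alg_iso _ A\<close> by (simp add: alg_iso_def quotient_algebra_carrier)
    have \<theta>_zero: "\<theta> J = \<zero>\<^bsub>A\<^esub>"
      using ring_hom_zero[OF \<theta>_hom J.quotient_is_ring A.ring_axioms] by (simp add: FactRing_def)
    have coset: "J +>\<^bsub>R\<^esub> f \<in> carrier (R Quot J)" if "f \<in> carrier R" for f
      using that ring_hom_closed[OF J.rcos_ring_hom] by blast
    let ?\<pi> = "\<lambda>f. \<theta> (J +>\<^bsub>R\<^esub> f)"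
    have ring_hom: "?\<pi> \<in> ring_hom R A"
      using ring_hom_trans[OF J.rcos_ring_hom \<theta>_hom] by (simp add: comp_def)
    have "?\<pi> (c \<odot>\<^bsub>R\<^esub> f) = c \<odot>\<^bsub>A\<^esub> ?\<pi> f" if f: "f \<in> carrier R" for c f
      using quotient_algebra_smult[OF R.assoc_algebra_axioms J.is_ideal f, of c] \<theta>_smult[OF coset[OF f], of c]
      by simp
    then have "?\<pi> \<in> alg_hom R A" using ring_hom by (simp add: alg_hom_def)
    moreover have "?\<pi> ` carrier R = carrier A"
    proof -
      have "carrier (R Quot J) = (\<lambda>f. J +>\<^bsub>R\<^esub> f) ` carrier R"
        by (auto simp: FactRing_def A_RCOSETS_def' )
      then show ?thesis using \<theta>_bij by (auto simp: bij_betw_def image_image)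
    qed
    moreover have "a_kernel R A ?\<pi> = J"
    proof -
      have "?\<pi> f = \<zero>\<^bsub>A\<^esub> \<longleftrightarrow> f \<in> J" if f: "f \<in> carrier R" for f
      proof -
        have J: "J \<in> carrier (R Quot J)"
          using ring.ring_simprules(2)[OF J.quotient_is_ring] by (simp add: FactRing_def)
        have "?\<pi> f = \<zero>\<^bsub>A\<^esub> \<longleftrightarrow> J +>\<^bsub>R\<^esub> f = J"
          using \<theta>_bij coset[OF f] J \<theta>_zero by (metis bij_betw_imp_inj_on inj_onD)
        also have "\<dots> \<longleftrightarrow> f \<in> J"
          using J.a_rcos_self[OF f] J.a_rcos_const by auto
        finally show ?thesis .
      qed
      then show ?thesis using J.Icarr by (auto simp: a_kernel_def')
    qed
    ultimately show ?thesis using gen by (intro bexI[of _ ?\<pi>]) auto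
  qed
  moreover have "\<exists>\<theta>\<in>alg_iso (quotient_algebra R J) A. \<forall>j\<in>T. \<theta> (J +>\<^bsub>R\<^esub> g j) = x j"
    if \<pi>: "\<pi> \<in> alg_hom R A" and surj: "\<pi> ` carrier R = carrier A" and ker: "a_kernel R A \<pi> = J"
      and gen: "\<forall>j\<in>T. \<pi> (g j) = x j" for \<pi>
  proof -
    interpret \<pi>: ring_hom_ring R A \<pi>
      using R.ring_axioms A.ring_axioms alg_hom_ring_hom[OF \<pi>] by (rule ring_hom_ringI2)
    let ?\<theta> = "\<lambda>X. the_elem (\<pi> ` X)"
    have iso: "?\<theta> \<in> ring_iso (R Quot J) A"
      using \<pi>.FactRing_iso_set[OF surj] ker by simp
    have \<theta>: "?\<theta> (J +>\<^bsub>R\<^esub> f) = \<pi> f" if f: "f \<in> carrier R" for f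
    proof -
      have "\<pi> a = \<pi> f" if a: "a \<in> J +>\<^bsub>R\<^esub> f" for a
      proof -
        from a obtain j where j: "j \<in> J" "a = j \<oplus>\<^bsub>R\<^esub> f" unfolding a_r_coset_def' by blast
        have "j \<in> a_kernel R A \<pi>" using j(1) unfolding ker .
        then have "j \<in> carrier R" "\<pi> j = \<zero>\<^bsub>A\<^esub>"
          unfolding a_kernel_def' by blast+
        then show ?thesis using alg_hom_add[OF \<pi>, of j f] alg_hom_closed[OF \<pi> f] f j(2) by simp
      qed
      then have "\<pi> ` (J +>\<^bsub>R\<^esub> f) = {\<pi> f}" using J.a_rcos_self[OF f] by blast
      then show ?thesis by simp
    qed
    have "?\<theta> (c \<odot>\<^bsub>quotient_algebra R J\<^esub> C) = c \<odot>\<^bsub>A\<^esub> ?\<theta> C" if "C \<in> carrier (R Quot J)" for c C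
    proof -
      from that obtain f where f: "f \<in> carrier R" "C = J +>\<^bsub>R\<^esub> f"
        by (auto simp: FactRing_def A_RCOSETS_def' )
      have "?\<theta> (c \<odot>\<^bsub>quotient_algebra R J\<^esub> C) = \<pi> (c \<odot>\<^bsub>R\<^esub> f)"
        using quotient_algebra_smult[OF R.assoc_algebra_axioms J.is_ideal f(1), of c]
          \<theta>[OF R.smult_closed'[OF f(1)], of c] f(2) by simp
      also have "\<dots> = c \<odot>\<^bsub>A\<^esub> ?\<theta> C"
        using alg_hom_smult[OF \<pi> f(1)] \<theta>[OF f(1)] f(2) by simp
      finally show ?thesis .
    qed
    then have "?\<theta> \<in> alg_iso (quotient_algebra R J) A"
      using iso by (simp add: alg_iso_def quotient_algebra_ring_iso quotient_algebra_carrier)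
    moreover have "\<forall>j\<in>T. ?\<theta> (J +>\<^bsub>R\<^esub> g j) = x j"
      using \<theta> gen g by simp
    ultimately show ?thesis by (intro bexI[of _ ?\<theta>])
  qed
  ultimately show ?thesis by blast
qed

lemma presented_as_iff:
  fixes A :: "('k::field, 'a, 'm) module_scheme"
  assumes P: "P \<subseteq> carrier (free_algebra n)"
  shows "presented_as A n x P \<longleftrightarrow> assoc_algebra A \<and>
    (\<exists>\<pi>\<in>alg_hom (free_algebra n) A. \<pi> ` carrier (free_algebra n) = carrier A \<and>
      a_kernel (free_algebra n) A \<pi> = genideal (free_algebra n) P \<and>
      (\<forall>j\<in>{1..n}. \<pi> (free_gen j) = x j))"
proof (cases "assoc_algebra A")
  case True
  interpret R: assoc_algebra "free_algebra n :: ('k, nat list \<Rightarrow> 'k) module"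
    by (rule free_algebra_assoc_algebra)
  show ?thesis
    unfolding presented_as_def
    using quotient_algebra_iso_iff[where x = x and T = "{1..n}" and g = free_gen, OF free_algebra_assoc_algebra True R.genideal_ideal[OF P]
        free_gen_closed] True
    by simp
qed (simp add: presented_as_def)

section \<open>Characters\<close>

lemma char_nonzero: "\<lbrakk>\<chi> \<in> carrier (char_group H); v \<in> carrier H\<rbrakk> \<Longrightarrow> \<chi> v \<noteq> 0"
  by (auto simp: char_group_def hom_def Pi_iff units_of_def Units_def dest!: bspec)

lemma char_mult: "\<lbrakk>\<chi> \<in> carrier (char_group H); v \<in> carrier H; w \<in> carrier H\<rbrakk> \<Longrightarrow>
    \<chi> (v \<otimes>\<^bsub>H\<^esub> w) = \<chi> v * \<chi> w"
  by (auto simp: char_group_def hom_def units_of_def)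

lemma char_one:
  assumes "group H" and "\<chi> \<in> carrier (char_group H)"
  shows "\<chi> \<one>\<^bsub>H\<^esub> = 1"
proof -
  interpret group H by fact
  have "\<chi> \<one>\<^bsub>H\<^esub> * \<chi> \<one>\<^bsub>H\<^esub> = \<chi> \<one>\<^bsub>H\<^esub>"
    using char_mult[OF assms(2), of "\<one>\<^bsub>H\<^esub>" "\<one>\<^bsub>H\<^esub>"] by simp
  then show ?thesis using char_nonzero[OF assms(2), of "\<one>\<^bsub>H\<^esub>"] by simp
qed

lemma char_group_simps:
  "v \<in> carrier H \<Longrightarrow> (\<chi> \<otimes>\<^bsub>char_group H\<^esub> \<psi>) v = \<chi> v * \<psi> v"
  "v \<in> carrier H \<Longrightarrow> \<one>\<^bsub>char_group H\<^esub> v = 1"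
  by (auto simp: char_group_def)

lemma char_ext:
  assumes "\<chi> \<in> carrier (char_group H)" and "\<psi> \<in> carrier (char_group H)"
    and "\<And>v. v \<in> carrier H \<Longrightarrow> \<chi> v = \<psi> v"
  shows "\<chi> = \<psi>"
  using assms by (auto simp: char_group_def intro: extensionalityI)

lemma char_group_comm_monoid:
  assumes "group H"
  shows "Group.comm_monoid (char_group H :: ('h \<Rightarrow> 'k::field) monoid)"
proof -
  interpret group H by fact
  have memI: "(\<lambda>v\<in>carrier H. f v) \<in> carrier (char_group H)"
    if "\<And>v. v \<in> carrier H \<Longrightarrow> f v \<noteq> (0::'k)"
      and "\<And>v w. \<lbrakk>v \<in> carrier H; w \<in> carrier H\<rbrakk> \<Longrightarrow> f (v \<otimes>\<^bsub>H\<^esub> w) = f v * f w" for f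
    using that by (auto simp: char_group_def hom_def units_of_def Units_def intro: left_inverse right_inverse)
  have mult: "\<chi> \<otimes>\<^bsub>char_group H\<^esub> \<psi> \<in> carrier (char_group H)"
    if "\<chi> \<in> carrier (char_group H)" "\<psi> \<in> carrier (char_group H)" for \<chi> \<psi> :: "'h \<Rightarrow> 'k"
    using memI[of "\<lambda>v. \<chi> v * \<psi> v"] that by (simp add: char_nonzero char_mult char_group_def[of H])
  have one: "\<one>\<^bsub>char_group H\<^esub> \<in> carrier (char_group H :: ('h \<Rightarrow> 'k) monoid)"
    using memI[of "\<lambda>v. 1"] by (simp add: char_group_def[of H])
  show ?thesis
  proof (rule comm_monoidI)
    fix \<chi> \<psi> \<phi> :: "'h \<Rightarrow> 'k"
    assume *: "\<chi> \<in> carrier (char_group H)" "\<psi> \<in> carrier (char_group H)" "\<phi> \<in> carrier (char_group H)"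
    show "\<chi> \<otimes>\<^bsub>char_group H\<^esub> \<psi> \<otimes>\<^bsub>char_group H\<^esub> \<phi> = \<chi> \<otimes>\<^bsub>char_group H\<^esub> (\<psi> \<otimes>\<^bsub>char_group H\<^esub> \<phi>)"
      by (rule char_ext[of _ H]) (simp_all add: * mult char_group_simps mult.assoc)
  next
    fix \<chi> :: "'h \<Rightarrow> 'k"
    assume *: "\<chi> \<in> carrier (char_group H)"
    show "\<one>\<^bsub>char_group H\<^esub> \<otimes>\<^bsub>char_group H\<^esub> \<chi> = \<chi>"
      by (rule char_ext[of _ H]) (simp_all add: * mult one char_group_simps)
  next
    fix \<chi> \<psi> :: "'h \<Rightarrow> 'k"
    assume *: "\<chi> \<in> carrier (char_group H)" "\<psi> \<in> carrier (char_group H)"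
    show "\<chi> \<otimes>\<^bsub>char_group H\<^esub> \<psi> = \<psi> \<otimes>\<^bsub>char_group H\<^esub> \<chi>"
      by (rule char_ext[of _ H]) (simp_all add: * mult char_group_simps mult.commute)
  qed (simp_all add: mult one)
qed

text \<open>
  If \<open>\<chi> w \<noteq> \<psi> w\<close> for some \<open>w\<close>, then substituting \<open>w v\<close> for \<open>v\<close> multiplies the sum by
  \<open>\<psi> w / \<chi> w \<noteq> 1\<close>, so the sum vanishes.
\<close>

lemma char_orthogonality:
  fixes \<chi> \<psi> :: "'h \<Rightarrow> 'k::field"
  assumes "group H" and "finite (carrier H)"
    and \<chi>: "\<chi> \<in> carrier (char_group H)" and \<psi>: "\<psi> \<in> carrier (char_group H)"
  shows "(\<Sum>v\<in>carrier H. inverse (\<chi> v) * \<psi> v) = (if \<chi> = \<psi> then of_nat (card (carrier H)) else 0)"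
proof (cases "\<chi> = \<psi>")
  case True
  then have "(\<Sum>v\<in>carrier H. inverse (\<chi> v) * \<psi> v) = (\<Sum>v\<in>carrier H. 1)"
    using char_nonzero[OF \<psi>] by (intro sum.cong) auto
  then show ?thesis using True by simp
next
  case False
  interpret group H by fact
  obtain w where w: "w \<in> carrier H" "\<chi> w \<noteq> \<psi> w"
    using False char_ext[OF \<chi> \<psi>] by blast
  let ?S = "\<Sum>v\<in>carrier H. inverse (\<chi> v) * \<psi> v"
  have "?S = (\<Sum>v\<in>carrier H. inverse (\<chi> (w \<otimes>\<^bsub>H\<^esub> v)) * \<psi> (w \<otimes>\<^bsub>H\<^esub> v))"
    using w(1) by (intro sum.reindex_bij_witness[of _ "\<lambda>v. w \<otimes>\<^bsub>H\<^esub> v" "\<lambda>v. inv\<^bsub>H\<^esub> w \<otimes>\<^bsub>H\<^esub> v"])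
      (auto simp: m_assoc[symmetric])
  also have "\<dots> = inverse (\<chi> w) * \<psi> w * ?S"
    using w(1) by (simp add: char_mult[OF \<chi>] char_mult[OF \<psi>] sum_distrib_left mult_ac)
  finally have "(inverse (\<chi> w) * \<psi> w - 1) * ?S = 0"
    by (simp add: algebra_simps)
  moreover have "inverse (\<chi> w) * \<psi> w \<noteq> 1"
    using w char_nonzero[OF \<chi> w(1)] by (auto simp: field_simps)
  ultimately show ?thesis using False by simp
qed

section \<open>Evaluating a twist at characters\<close>

text \<open>
  A function that is multiplicative on a subgroup \<open>K\<close>, extended by zero, is multiplicative on a
  product \<open>a b\<close> as soon as \<open>b\<close> is supported in \<open>K\<close>: from \<open>x y \<in> K\<close> and \<open>y \<in> K\<close> follows
  \<open>x \<in> K\<close>.  The factor \<open>a\<close> is left arbitrary because it will be the inverse of the twist in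
  \<open>k[G] \<otimes> k[G]\<close>, which is not known in advance to lie in \<open>k[V] \<otimes> k[V]\<close>.
\<close>

lemma group_algebra_mult_eval:
  fixes a b :: "'h \<Rightarrow> 'k::field"
  assumes "group H" and "finite (carrier H)" and "subgroup K H"
    and b: "\<And>y. y \<notin> K \<Longrightarrow> b y = 0"
    and l: "\<And>x y. \<lbrakk>x \<in> K; y \<in> K\<rbrakk> \<Longrightarrow> l (x \<otimes>\<^bsub>H\<^esub> y) = l x * l y"
  shows "(\<Sum>g\<in>K. (a \<otimes>\<^bsub>group_algebra H :: ('k, 'h \<Rightarrow> 'k) module\<^esub> b) g * l g) =
    (\<Sum>x\<in>K. a x * l x) * (\<Sum>y\<in>K. b y * l y)"
proof -
  interpret group H by fact
  interpret K: subgroup K H by fact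
  have finK: "finite K" using K.subset assms(2) by (rule finite_subset)
  let ?m = "\<lambda>t. fst t \<otimes>\<^bsub>H\<^esub> snd t"
  have "(\<Sum>g\<in>K. (a \<otimes>\<^bsub>group_algebra H :: ('k, 'h \<Rightarrow> 'k) module\<^esub> b) g * l g) =
    (\<Sum>g\<in>K. \<Sum>t\<in>{t \<in> K \<times> K. ?m t = g}. (a (fst t) * l (fst t)) * (b (snd t) * l (snd t)))"
  proof (rule sum.cong[OF refl])
    fix g assume g: "g \<in> K"
    have bK: "y \<in> K" if "b y \<noteq> 0" for y
      using b that by blast
    have xK: "x \<in> K" if "g = x \<otimes>\<^bsub>H\<^esub> y" "b y \<noteq> 0" "x \<in> carrier H" for x y
    proof -
      have "x = g \<otimes>\<^bsub>H\<^esub> inv\<^bsub>H\<^esub> y" using that bK K.subset g by (subst inv_solve_right) auto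
      moreover have "g \<otimes>\<^bsub>H\<^esub> inv\<^bsub>H\<^esub> y \<in> K" using g bK[OF that(2)] by simp
      ultimately show ?thesis by metis
    qed
    have "(\<Sum>(x, y)\<in>{(x, y). x \<in> carrier H \<and> y \<in> carrier H \<and> x \<otimes>\<^bsub>H\<^esub> y = g}. a x * b y)
      = (\<Sum>t\<in>{t \<in> K \<times> K. ?m t = g}. a (fst t) * b (snd t))"
    proof (rule sum.mono_neutral_cong_right)
      show "finite {(x, y). x \<in> carrier H \<and> y \<in> carrier H \<and> x \<otimes>\<^bsub>H\<^esub> y = g}"
        by (rule finite_subset[of _ "carrier H \<times> carrier H"]) (use assms(2) in auto)
    qed (auto intro: xK bK)
    moreover have "a (fst t) * b (snd t) * l g = (a (fst t) * l (fst t)) * (b (snd t) * l (snd t))"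
      if "t \<in> {t \<in> K \<times> K. ?m t = g}" for t
      using that l by auto
    ultimately show "(a \<otimes>\<^bsub>group_algebra H :: ('k, 'h \<Rightarrow> 'k) module\<^esub> b) g * l g =
        (\<Sum>t\<in>{t \<in> K \<times> K. ?m t = g}. (a (fst t) * l (fst t)) * (b (snd t) * l (snd t)))"
      by (simp add: group_algebra_def sum_distrib_right) (rule sum.cong, auto)
  qed
  also have "\<dots> = (\<Sum>t\<in>K \<times> K. (a (fst t) * l (fst t)) * (b (snd t) * l (snd t)))"
    using finK by (intro sum.group) auto
  also have "\<dots> = (\<Sum>x\<in>K. a x * l x) * (\<Sum>y\<in>K. b y * l y)"
    by (simp add: sum_product sum.cartesian_product case_prod_beta)
  finally show ?thesis .
qed

lemma linear_ext_restrict: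
  assumes "finite B" and "B' \<subseteq> B" and "\<And>x. x \<notin> B' \<Longrightarrow> a x = 0"
  shows "linear_ext B \<phi> a = linear_ext B' \<phi> a"
  unfolding linear_ext_def using assms by (intro ext sum.mono_neutral_right) auto

lemma linear_ext_eval:
  assumes "finite B" and "finite K" and "\<phi> ` B \<subseteq> K"
  shows "(\<Sum>y\<in>K. linear_ext B \<phi> a y * l y) = (\<Sum>x\<in>B. a x * l (\<phi> x))"
proof -
  have "(\<Sum>y\<in>K. linear_ext B \<phi> a y * l y) = (\<Sum>y\<in>K. \<Sum>x\<in>{x \<in> B. \<phi> x = y}. a x * l (\<phi> x))"
    by (auto simp: linear_ext_def sum_distrib_right intro!: sum.cong)
  also have "\<dots> = (\<Sum>x\<in>B. a x * l (\<phi> x))" using assms by (rule sum.group)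
  finally show ?thesis .
qed

lemma linear_ext_outside: "\<lbrakk>\<phi> ` B \<subseteq> K; y \<notin> K\<rbrakk> \<Longrightarrow> linear_ext B \<phi> a y = 0"
  unfolding linear_ext_def by (intro sum.neutral) auto

locale subgroup_twist = group G
  for G :: "('g, 'm) monoid_scheme" (structure) +
  fixes V :: "'g set" and F :: "'g \<times> 'g \<Rightarrow> 'k::field"
    and \<sigma> :: "('g \<Rightarrow> 'k) \<Rightarrow> ('g \<Rightarrow> 'k) \<Rightarrow> 'k"
  assumes finite_G: "finite (carrier G)"
    and V: "subgroup V G"
    and F_carrier: "F \<in> carrier (group_algebra (G\<lparr>carrier := V\<rparr> \<times>\<times> (G\<lparr>carrier := V\<rparr>)))"
    and twist: "drinfeld_twist G F"
    and cocycle: "twist_cocycle (G\<lparr>carrier := V\<rparr>) F \<sigma>"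
begin

abbreviation \<V> :: "('g, 'm) monoid_scheme" where "\<V> \<equiv> G\<lparr>carrier := V\<rparr>"
abbreviation chars :: "('g \<Rightarrow> 'k) monoid" where "chars \<equiv> char_group \<V>"

sublocale V: group \<V>
  using V by (rule subgroup_imp_group)

sublocale chars: Group.comm_monoid chars
  by (rule char_group_comm_monoid) (rule V.is_group)

lemma V_subset: "V \<subseteq> carrier G"
  using V by (rule subgroup.subset)

lemma finite_V: "finite V"
  using V_subset finite_G by (rule finite_subset)

lemma F_support: "t \<notin> V \<times> V \<Longrightarrow> F t = 0"
  using F_carrier by (cases t) (auto simp: group_algebra_def DirProd_def)

lemma char_V:
  assumes "\<chi> \<in> carrier chars"
  shows "\<lbrakk>v \<in> V; w \<in> V\<rbrakk> \<Longrightarrow> \<chi> (v \<otimes> w) = \<chi> v * \<chi> w" and "\<chi> \<one> = 1"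
  using char_mult[OF assms, of v w] char_one[OF V.is_group assms] by auto

lemma F_nonzero: "F \<noteq> (\<lambda>t. 0)"
proof
  assume F0: "F = (\<lambda>t. 0)"
  from twist obtain F' where "F \<otimes>\<^bsub>group_algebra (G \<times>\<times> G) :: ('k, 'g \<times> 'g \<Rightarrow> 'k) module\<^esub> F' =
      \<one>\<^bsub>group_algebra (G \<times>\<times> G) :: ('k, 'g \<times> 'g \<Rightarrow> 'k) module\<^esub>"
    unfolding drinfeld_twist_def Units_def by blast
  from fun_cong[OF this, of "\<one>\<^bsub>G \<times>\<times> G\<^esub>"] show False
    by (simp add: F0 group_algebra_def)
qed

lemma F_eq: "F (g, h) = (\<Sum>\<chi>\<in>carrier chars. \<Sum>\<psi>\<in>carrier chars.
    \<sigma> \<chi> \<psi> * (char_idem \<V> \<chi> g * char_idem \<V> \<psi> h))"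
  using cocycle unfolding twist_cocycle_def by (metis (lifting) case_prod_conv)

text \<open>
  This fact and the next one hold because otherwise the expansion of \<open>F\<close> in the idempotents would
  be zero: a sum over an infinite set and the inverse of \<open>0\<close> are both read as \<open>0\<close>.
\<close>

lemma finite_chars: "finite (carrier chars)"
proof (rule ccontr)
  assume "infinite (carrier chars)"
  then have "F = (\<lambda>t. 0)" by (auto simp: fun_eq_iff F_eq)
  then show False using F_nonzero by simp
qed

lemma card_V_nonzero: "of_nat (card V) \<noteq> (0::'k)"
proof
  assume "of_nat (card V) = (0::'k)"
  then have "char_idem \<V> \<chi> v = (0::'k)" for \<chi> v
    by (simp add: char_idem_def)
  then have "F = (\<lambda>t. 0)" by (auto simp: fun_eq_iff F_eq)
  then show False using F_nonzero by simp
qed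

lemma char_idem_eval:
  assumes "\<chi> \<in> carrier chars" and "\<psi> \<in> carrier chars"
  shows "(\<Sum>v\<in>V. char_idem \<V> \<chi> v * \<psi> v) = (if \<chi> = \<psi> then 1 else 0)"
proof -
  have "(\<Sum>v\<in>V. char_idem \<V> \<chi> v * \<psi> v)
    = inverse (of_nat (card V)) * (\<Sum>v\<in>V. inverse (\<chi> v) * \<psi> v)"
    by (simp add: char_idem_def sum_distrib_left mult.assoc)
  then show ?thesis
    using char_orthogonality[OF V.is_group _ assms] finite_V card_V_nonzero by simp
qed

text \<open>
  The value of \<open>\<sigma>\<close> is the scalar by which \<open>F\<close> acts on a tensor product of two eigenvectors.
\<close>

lemma sigma_eval:
  assumes \<chi>: "\<chi> \<in> carrier chars" and \<psi>: "\<psi> \<in> carrier chars"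
  shows "(\<Sum>t\<in>V \<times> V. F t * (\<chi> (fst t) * \<psi> (snd t))) = \<sigma> \<chi> \<psi>"
proof -
  let ?C = "carrier chars"
  let ?e = "\<lambda>p t. (char_idem \<V> (fst p) (fst t) * \<chi> (fst t)) * (char_idem \<V> (snd p) (snd t) * \<psi> (snd t))"
  have F: "F t * (\<chi> (fst t) * \<psi> (snd t)) = (\<Sum>p\<in>?C \<times> ?C. \<sigma> (fst p) (snd p) * ?e p t)" for t
    by (cases t) (simp add: F_eq sum.cartesian_product case_prod_beta sum_distrib_left sum_distrib_right mult_ac)
  have e: "(\<Sum>t\<in>V \<times> V. ?e p t) = (if p = (\<chi>, \<psi>) then 1 else 0)" if "p \<in> ?C \<times> ?C" for p
  proof -
    have "(\<Sum>t\<in>V \<times> V. ?e p t) =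
        (\<Sum>g\<in>V. char_idem \<V> (fst p) g * \<chi> g) * (\<Sum>h\<in>V. char_idem \<V> (snd p) h * \<psi> h)"
      unfolding sum_product sum.cartesian_product by (simp add: case_prod_beta)
    then show ?thesis
      using that by (cases p) (simp add: char_idem_eval \<chi> \<psi>)
  qed
  have "(\<Sum>t\<in>V \<times> V. F t * (\<chi> (fst t) * \<psi> (snd t)))
    = (\<Sum>t\<in>V \<times> V. \<Sum>p\<in>?C \<times> ?C. \<sigma> (fst p) (snd p) * ?e p t)"
    by (intro sum.cong refl F)
  also have "\<dots> = (\<Sum>p\<in>?C \<times> ?C. \<Sum>t\<in>V \<times> V. \<sigma> (fst p) (snd p) * ?e p t)"
    by (rule sum.swap)
  also have "\<dots> = (\<Sum>p\<in>?C \<times> ?C. \<sigma> (fst p) (snd p) * (\<Sum>t\<in>V \<times> V. ?e p t))"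
    by (intro sum.cong refl) (rule sum_distrib_left[symmetric])
  also have "\<dots> = (\<Sum>p\<in>?C \<times> ?C. if p = (\<chi>, \<psi>) then \<sigma> (fst p) (snd p) else 0)"
    by (intro sum.cong refl) (simp add: e)
  also have "\<dots> = \<sigma> \<chi> \<psi>"
    using finite_chars \<chi> \<psi> by (simp add: sum.delta)
  finally show ?thesis .
qed

lemma subgroup_V2: "subgroup (V \<times> V) (G \<times>\<times> G)"
  by (rule DirProd_subgroups) (simp_all add: V)

lemma subgroup_V3: "subgroup (V \<times> V \<times> V) (G \<times>\<times> G \<times>\<times> G)"
  by (rule DirProd_subgroups) (simp_all add: V subgroup_V2 DirProd_group)

text \<open>
  Evaluating \<open>F' F = 1\<close> at the pair of characters exhibits an inverse of \<open>\<sigma> \<chi> \<psi>\<close>.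
\<close>

lemma sigma_nonzero:
  assumes \<chi>: "\<chi> \<in> carrier chars" and \<psi>: "\<psi> \<in> carrier chars"
  shows "\<sigma> \<chi> \<psi> \<noteq> 0"
proof
  assume \<sigma>0: "\<sigma> \<chi> \<psi> = 0"
  let ?l = "\<lambda>t. \<chi> (fst t) * \<psi> (snd t)"
  from twist obtain F' where F': "F' \<otimes>\<^bsub>group_algebra (G \<times>\<times> G) :: ('k, 'g \<times> 'g \<Rightarrow> 'k) module\<^esub> F =
      \<one>\<^bsub>group_algebra (G \<times>\<times> G) :: ('k, 'g \<times> 'g \<Rightarrow> 'k) module\<^esub>"
    unfolding drinfeld_twist_def Units_def by blast
  have "(\<Sum>t\<in>V \<times> V. \<one>\<^bsub>group_algebra (G \<times>\<times> G) :: ('k, 'g \<times> 'g \<Rightarrow> 'k) module\<^esub> t * ?l t)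
    = (\<Sum>t\<in>V \<times> V. F' t * ?l t) * (\<Sum>t\<in>V \<times> V. F t * ?l t)"
    unfolding F'[symmetric]
    using finite_G F_support
    by (intro group_algebra_mult_eval DirProd_group subgroup_V2)
      (auto simp: is_group char_V[OF \<chi>] char_V[OF \<psi>] mult_ac)
  then have "(\<Sum>t\<in>V \<times> V. \<one>\<^bsub>group_algebra (G \<times>\<times> G) :: ('k, 'g \<times> 'g \<Rightarrow> 'k) module\<^esub> t * ?l t) = 0"
    using \<sigma>0 by (simp only: sigma_eval[OF \<chi> \<psi>]) simp
  moreover have "(\<Sum>t\<in>V \<times> V. \<one>\<^bsub>group_algebra (G \<times>\<times> G) :: ('k, 'g \<times> 'g \<Rightarrow> 'k) module\<^esub> t * ?l t)
    = (\<Sum>t\<in>V \<times> V. if t = (\<one>, \<one>) then 1 else 0)"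
    by (intro sum.cong refl) (auto simp: group_algebra_def DirProd_def char_V[OF \<chi>] char_V[OF \<psi>])
  moreover have "\<dots> = 1"
    using finite_V subgroup.one_closed[OF V] by (simp add: sum.delta)
  ultimately show False by simp
qed

text \<open>
  The twist equation, evaluated at \<open>\<chi> \<otimes> \<psi> \<otimes> \<phi>\<close>: evaluation after \<open>\<Delta> \<otimes> id\<close> is evaluation at
  \<open>\<chi>\<psi> \<otimes> \<phi>\<close>, since \<open>\<Delta>\<close> doubles group elements.
\<close>

lemma sigma_cocycle:
  assumes \<chi>: "\<chi> \<in> carrier chars" and \<psi>: "\<psi> \<in> carrier chars" and \<phi>: "\<phi> \<in> carrier chars"
  shows "\<sigma> \<chi> \<psi> * \<sigma> (\<chi> \<otimes>\<^bsub>chars\<^esub> \<psi>) \<phi> = \<sigma> \<psi> \<phi> * \<sigma> \<chi> (\<psi> \<otimes>\<^bsub>chars\<^esub> \<phi>)"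
proof -
  let ?l = "\<lambda>t. \<chi> (fst t) * (\<psi> (fst (snd t)) * \<phi> (snd (snd t)))"
  let ?H = "group_algebra (G \<times>\<times> G \<times>\<times> G) :: ('k, 'g \<times> 'g \<times> 'g \<Rightarrow> 'k) module"
  let ?K = "V \<times> V \<times> V"
  have restrict: "linear_ext (carrier (G \<times>\<times> G)) f F = linear_ext (V \<times> V) f F"
    for f :: "'g \<times> 'g \<Rightarrow> 'g \<times> 'g \<times> 'g"
    using finite_G V_subset F_support by (intro linear_ext_restrict) auto
  have "\<one> \<in> V" by (rule subgroup.one_closed[OF V])
  have mult: "(\<Sum>t\<in>?K. (a \<otimes>\<^bsub>?H\<^esub> b) t * ?l t) = (\<Sum>t\<in>?K. a t * ?l t) * (\<Sum>t\<in>?K. b t * ?l t)"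
    if "\<And>t. t \<notin> ?K \<Longrightarrow> b t = 0" for a b
    using finite_G that
    by (intro group_algebra_mult_eval DirProd_group subgroup_V3)
      (auto simp: is_group char_V[OF \<chi>] char_V[OF \<psi>] char_V[OF \<phi>] mult_ac)
  have "(\<Sum>t\<in>?K. tensor_one G F t * ?l t) = \<sigma> \<chi> \<psi>"
    unfolding tensor_one_def restrict using \<open>\<one> \<in> V\<close> finite_V
    by (subst linear_ext_eval) (auto simp: sigma_eval[OF \<chi> \<psi>, symmetric] char_V[OF \<phi>] case_prod_beta)
  moreover have "(\<Sum>t\<in>?K. one_tensor G F t * ?l t) = \<sigma> \<psi> \<phi>"
    unfolding one_tensor_def restrict using \<open>\<one> \<in> V\<close> finite_V
    by (subst linear_ext_eval) (auto simp: sigma_eval[OF \<psi> \<phi>, symmetric] char_V[OF \<chi>] case_prod_beta)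
  moreover have "(\<Sum>t\<in>?K. comult_id G F t * ?l t) = \<sigma> (\<chi> \<otimes>\<^bsub>chars\<^esub> \<psi>) \<phi>"
    unfolding comult_id_def restrict using finite_V
    by (subst linear_ext_eval)
      (auto simp: sigma_eval[OF chars.m_closed[OF \<chi> \<psi>] \<phi>, symmetric] char_group_simps case_prod_beta mult_ac
        intro!: sum.cong)
  moreover have "(\<Sum>t\<in>?K. id_comult G F t * ?l t) = \<sigma> \<chi> (\<psi> \<otimes>\<^bsub>chars\<^esub> \<phi>)"
    unfolding id_comult_def restrict using finite_V
    by (subst linear_ext_eval)
      (auto simp: sigma_eval[OF \<chi> chars.m_closed[OF \<psi> \<phi>], symmetric] char_group_simps case_prod_beta mult_ac
        intro!: sum.cong)
  moreover have "comult_id G F t = 0" "id_comult G F t = 0" if "t \<notin> ?K" for t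
    unfolding comult_id_def id_comult_def restrict using that
    by (auto intro!: linear_ext_outside[of _ _ ?K])
  moreover have "tensor_one G F \<otimes>\<^bsub>?H\<^esub> comult_id G F = one_tensor G F \<otimes>\<^bsub>?H\<^esub> id_comult G F"
    using twist by (simp add: drinfeld_twist_def)
  ultimately show ?thesis
    using mult[of "comult_id G F" "tensor_one G F"] mult[of "id_comult G F" "one_tensor G F"] by simp
qed

text \<open>
  The cocycle identity at \<open>(1, 1, \<chi>)\<close> and at \<open>(\<chi>, 1, 1)\<close>, with a nonzero factor cancelled.
\<close>

lemma sigma_one:
  assumes \<chi>: "\<chi> \<in> carrier chars"
  shows sigma_one_left: "\<sigma> \<one>\<^bsub>chars\<^esub> \<chi> = \<sigma> \<one>\<^bsub>chars\<^esub> \<one>\<^bsub>chars\<^esub>"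
    and sigma_one_right: "\<sigma> \<chi> \<one>\<^bsub>chars\<^esub> = \<sigma> \<one>\<^bsub>chars\<^esub> \<one>\<^bsub>chars\<^esub>"
proof -
  show "\<sigma> \<one>\<^bsub>chars\<^esub> \<chi> = \<sigma> \<one>\<^bsub>chars\<^esub> \<one>\<^bsub>chars\<^esub>"
    using sigma_cocycle[of "\<one>\<^bsub>chars\<^esub>" "\<one>\<^bsub>chars\<^esub>" \<chi>] sigma_nonzero[of "\<one>\<^bsub>chars\<^esub>" \<chi>] \<chi> by simp
  show "\<sigma> \<chi> \<one>\<^bsub>chars\<^esub> = \<sigma> \<one>\<^bsub>chars\<^esub> \<one>\<^bsub>chars\<^esub>"
    using sigma_cocycle[of \<chi> "\<one>\<^bsub>chars\<^esub>" "\<one>\<^bsub>chars\<^esub>"] sigma_nonzero[of \<chi> "\<one>\<^bsub>chars\<^esub>"] \<chi> by simp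
qed

end

section \<open>The grading of the free algebra by characters\<close>

locale graded_generators = subgroup_twist G V F \<sigma>
  for G :: "('g, 'm) monoid_scheme" (structure) and V F
    and \<sigma> :: "('g \<Rightarrow> 'k::field) \<Rightarrow> ('g \<Rightarrow> 'k) \<Rightarrow> 'k" +
  fixes n :: nat and \<chi> :: "nat \<Rightarrow> 'g \<Rightarrow> 'k"
  assumes gen_char: "j \<in> {1..n} \<Longrightarrow> \<chi> j \<in> carrier chars"
begin

abbreviation R :: "('k, nat list \<Rightarrow> 'k) module" where "R \<equiv> free_algebra n"
abbreviation wc :: "nat list \<Rightarrow> 'g \<Rightarrow> 'k" where "wc \<equiv> word_char \<V> \<chi>"
abbreviation kc :: "nat list \<Rightarrow> 'k" where "kc \<equiv> kappa_coeff \<V> \<sigma> \<chi>"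

sublocale R: assoc_algebra R
  by (rule free_algebra_assoc_algebra)

lemma word_char_closed: "letters_in n w \<Longrightarrow> wc w \<in> carrier chars"
  by (induction w) (auto simp: word_char_def gen_char)

lemma word_char_append:
  "\<lbrakk>letters_in n u; letters_in n v\<rbrakk> \<Longrightarrow> wc (u @ v) = wc u \<otimes>\<^bsub>chars\<^esub> wc v"
proof (induction u)
  case Nil
  then show ?case using word_char_closed[of v] by (simp add: word_char_def)
next
  case (Cons j u)
  moreover have "wc (j # w) = \<chi> j \<otimes>\<^bsub>chars\<^esub> wc w" for w by (simp add: word_char_def)
  ultimately show ?case
    using gen_char[of j] word_char_closed[of u] word_char_closed[of v] by (simp add: chars.m_assoc)
qed

lemma word_char_single: "j \<in> {1..n} \<Longrightarrow> wc [j] = \<chi> j"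
  using gen_char[of j] by (simp add: word_char_def)

lemma word_char_append_apply:
  "\<lbrakk>letters_in n u; letters_in n v; t \<in> V\<rbrakk> \<Longrightarrow> wc (u @ v) t = wc u t * wc v t"
  by (simp add: word_char_append char_group_simps)

lemma kappa_coeff_nonzero:
  assumes "letters_in n w"
  shows "kc w \<noteq> 0"
proof -
  have "\<sigma> (wc (take s w)) (\<chi> (w ! s)) \<noteq> 0" if "s \<in> {1..<length w}" for s
  proof (rule sigma_nonzero[OF word_char_closed gen_char])
    show "letters_in n (take s w)" using assms set_take_subset[of s w] by (rule subset_trans[rotated])
    have "w ! s \<in> set w" using that by (intro nth_mem) simp
    then show "w ! s \<in> {1..n}" using assms by (rule subsetD[rotated])
  qed
  then show ?thesis by (simp add: kappa_coeff_def sigma_nonzero)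
qed

text \<open>
  The recursion for \<open>\<kappa>\<close> includes the empty word: its coefficient \<open>\<sigma>(1, 1)\<close> cancels against
  \<open>\<sigma>(1, \<chi>\<^sub>j)\<inverse>\<close>, which leaves the coefficient \<open>1\<close> of a single letter.
\<close>

lemma kappa_coeff_snoc:
  assumes "letters_in n w" and j: "j \<in> {1..n}"
  shows "kc w = kc (w @ [j]) * \<sigma> (wc w) (\<chi> j)"
proof (cases "w = []")
  case True
  then show ?thesis
    using sigma_one_left[OF gen_char[OF j]] by (simp add: kappa_coeff_def word_char_def)
next
  case False
  then have "{1..<length (w @ [j])} = insert (length w) {1..<length w}" by (cases w) auto
  then have "kc (w @ [j]) = inverse (\<sigma> (wc w) (\<chi> j)) * kc w"
    using False by (simp add: kappa_coeff_def nth_append)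
  then show ?thesis
    using sigma_nonzero[OF word_char_closed[OF assms(1)] gen_char[OF j]] by simp
qed

text \<open>
  Both \<open>\<kappa>\<^sub>u \<kappa>\<^sub>v\<close> and \<open>\<kappa>\<^sub>u\<^sub>v\<close> describe iterated products of the letters, bracketed differently; the
  cocycle identity makes up for the difference when one more letter is appended to \<open>v\<close>.
\<close>

lemma kappa_coeff_append:
  assumes "letters_in n u" and "letters_in n v"
  shows "kc u * kc v = kc (u @ v) * \<sigma> (wc u) (wc v)"
  using assms(2)
proof (induction v rule: rev_induct)
  case Nil
  then show ?case
    using sigma_one_right[OF word_char_closed[OF assms(1)]] by (simp add: kappa_coeff_def word_char_def)
next
  case (snoc j v)
  let ?U = "wc u" and ?W = "wc v"
  have c: "?U \<in> carrier chars" "?W \<in> carrier chars" "\<chi> j \<in> carrier chars"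
    using assms snoc.prems by (auto simp: word_char_closed gen_char)
  have IH: "kc u * kc v = kc (u @ v) * \<sigma> ?U ?W"
    using snoc by simp
  have v: "kc v = kc (v @ [j]) * \<sigma> ?W (\<chi> j)"
    using snoc.prems by (intro kappa_coeff_snoc) auto
  have uv: "kc (u @ v) = kc (u @ v @ [j]) * \<sigma> (?U \<otimes>\<^bsub>chars\<^esub> ?W) (\<chi> j)"
    using snoc.prems assms(1) kappa_coeff_snoc[of "u @ v" j] by (simp add: word_char_append)
  have "\<sigma> ?W (\<chi> j) * (kc u * kc (v @ [j]))
    = kc (u @ v @ [j]) * (\<sigma> ?U ?W * \<sigma> (?U \<otimes>\<^bsub>chars\<^esub> ?W) (\<chi> j))"
    using IH unfolding v uv by (simp add: mult_ac)
  also have "\<dots> = \<sigma> ?W (\<chi> j) * (kc (u @ v @ [j]) * \<sigma> ?U (?W \<otimes>\<^bsub>chars\<^esub> \<chi> j))"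
    unfolding sigma_cocycle[OF c] by (simp add: mult_ac)
  finally have "kc u * kc (v @ [j]) = kc (u @ v @ [j]) * \<sigma> ?U (?W \<otimes>\<^bsub>chars\<^esub> \<chi> j)"
    using sigma_nonzero[OF c(2,3)] by simp
  moreover have "wc (v @ [j]) = ?W \<otimes>\<^bsub>chars\<^esub> \<chi> j"
    using snoc.prems word_char_append[of v "[j]"] word_char_single[of j] by simp
  ultimately show ?case by simp
qed

text \<open>
  The operators that are scalar on every homogeneous component.  Evaluation at \<open>v \<in> V\<close> as \<open>c\<close> gives
  the action of \<open>v\<close>, an indicator function as \<open>c\<close> gives the projection onto a component.
\<close>

definition char_scale :: "(('g \<Rightarrow> 'k) \<Rightarrow> 'k) \<Rightarrow> (nat list \<Rightarrow> 'k) \<Rightarrow> nat list \<Rightarrow> 'k" where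
  "char_scale c f = (\<lambda>w. c (wc w) * f w)"

lemma char_scale_closed: "f \<in> carrier R \<Longrightarrow> char_scale c f \<in> carrier R"
  by (erule free_algebra_carrierI) (auto simp: char_scale_def)

lemma kappa_closed: "f \<in> carrier R \<Longrightarrow> kappa \<V> \<sigma> \<chi> f \<in> carrier R"
  by (erule free_algebra_carrierI) (auto simp: kappa_def)

lemma char_scale_alg_hom:
  assumes t: "t \<in> V"
  shows "char_scale (\<lambda>\<psi>. \<psi> t) \<in> alg_hom R R"
proof (rule alg_homI)
  fix f g assume f: "f \<in> carrier R" and g: "g \<in> carrier R"
  show "char_scale (\<lambda>\<psi>. \<psi> t) (f \<otimes>\<^bsub>R\<^esub> g) = char_scale (\<lambda>\<psi>. \<psi> t) f \<otimes>\<^bsub>R\<^esub> char_scale (\<lambda>\<psi>. \<psi> t) g"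
    using free_mult_cong[OF f g, of "\<lambda>u v. wc (u @ v) t" "\<lambda>u v. wc u t * wc v t"]
    by (simp add: char_scale_def sum_distrib_left word_char_append_apply t mult_ac)
qed (auto simp: char_scale_closed, auto simp: char_scale_def algebra_simps free_word_def word_char_def char_group_simps t)

lemma char_scale_gen:
  "j \<in> {1..n} \<Longrightarrow> char_scale c (free_gen j) = (\<lambda>w. c (\<chi> j) * free_gen j w)"
  using word_char_single[of j] by (auto simp: char_scale_def free_gen_def)

definition unkappa :: "(nat list \<Rightarrow> 'k) \<Rightarrow> nat list \<Rightarrow> 'k" where
  "unkappa f = (\<lambda>w. inverse (kc w) * f w)"

lemma unkappa_closed: "f \<in> carrier R \<Longrightarrow> unkappa f \<in> carrier R"
  by (erule free_algebra_carrierI) (auto simp: unkappa_def)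

lemma unkappa_kappa:
  assumes "f \<in> carrier R"
  shows "unkappa (kappa \<V> \<sigma> \<chi> f) = f" and "kappa \<V> \<sigma> \<chi> (unkappa f) = f"
  using assms kappa_coeff_nonzero
  by (auto simp: fun_eq_iff unkappa_def kappa_def free_algebra_carrier)

text \<open>
  Hence \<open>\<kappa>\<inverse>\<close> turns the product of the free algebra into the product twisted by \<open>\<sigma>\<close>.
\<close>

lemma unkappa_mult:
  assumes f: "f \<in> carrier R" and g: "g \<in> carrier R"
  shows "unkappa (f \<otimes>\<^bsub>R\<^esub> g) = (\<lambda>w. \<Sum>i\<le>length w. \<sigma> (wc (take i w)) (wc (drop i w)) *
    (unkappa f (take i w) * unkappa g (drop i w)))"
proof
  fix w
  have "inverse (kc (u @ v)) = \<sigma> (wc u) (wc v) * inverse (kc u) * inverse (kc v)"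
    if "letters_in n u" "letters_in n v" for u v
    using kappa_coeff_append[OF that] kappa_coeff_nonzero[of u] kappa_coeff_nonzero[of v]
      kappa_coeff_nonzero[of "u @ v"] that
    by (auto simp: field_simps)
  from free_mult_cong[OF f g, of "\<lambda>u v. inverse (kc (u @ v))"
      "\<lambda>u v. \<sigma> (wc u) (wc v) * inverse (kc u) * inverse (kc v)", OF this, of w]
  show "unkappa (f \<otimes>\<^bsub>R\<^esub> g) w = (\<Sum>i\<le>length w. \<sigma> (wc (take i w)) (wc (drop i w)) *
    (unkappa f (take i w) * unkappa g (drop i w)))"
    by (simp add: unkappa_def sum_distrib_left mult_ac)
qed

abbreviation \<kappa> :: "(nat list \<Rightarrow> 'k) \<Rightarrow> nat list \<Rightarrow> 'k" where "\<kappa> \<equiv> kappa \<V> \<sigma> \<chi>"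

text \<open>
  On homogeneous elements \<open>\<kappa>\<close> is multiplicative up to \<open>\<sigma>\<close>.  The hypothesis separates the
  dependence on the two characters, so that no decomposition of \<open>f\<close> and \<open>g\<close> into components needs
  to be carried along.
\<close>

lemma kappa_char_scale_mult:
  assumes f: "f \<in> carrier R" and g: "g \<in> carrier R"
    and decomp: "\<And>\<phi> \<psi>. \<lbrakk>\<phi> \<in> carrier chars; \<psi> \<in> carrier chars\<rbrakk> \<Longrightarrow>
      c (\<phi> \<otimes>\<^bsub>chars\<^esub> \<psi>) * inverse (\<sigma> \<phi> \<psi>) = (\<Sum>t\<in>T. a t \<phi> * b t \<psi>)"
  shows "\<kappa> (char_scale c (f \<otimes>\<^bsub>R\<^esub> g)) =
    (\<lambda>w. \<Sum>t\<in>T. (\<kappa> (char_scale (a t) f) \<otimes>\<^bsub>R\<^esub> \<kappa> (char_scale (b t) g)) w)"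
proof
  fix w
  let ?d = "\<lambda>t u v. (kc u * a t (wc u)) * (kc v * b t (wc v))"
  have coeff: "kc (u @ v) * c (wc (u @ v)) = (\<Sum>t\<in>T. ?d t u v)"
    if u: "letters_in n u" and v: "letters_in n v" for u v
  proof -
    have "(\<Sum>t\<in>T. ?d t u v) = kc u * kc v * (\<Sum>t\<in>T. a t (wc u) * b t (wc v))"
      by (simp add: sum_distrib_left mult_ac)
    also have "\<dots> = kc u * kc v * (c (wc u \<otimes>\<^bsub>chars\<^esub> wc v) * inverse (\<sigma> (wc u) (wc v)))"
      by (simp only: decomp[OF word_char_closed[OF u] word_char_closed[OF v]])
    also have "\<dots> = kc (u @ v) * c (wc (u @ v))"
      using kappa_coeff_append[OF u v] sigma_nonzero[OF word_char_closed[OF u] word_char_closed[OF v]]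
      by (simp add: word_char_append[OF u v])
    finally show ?thesis ..
  qed
  have "\<kappa> (char_scale c (f \<otimes>\<^bsub>R\<^esub> g)) w =
    (\<Sum>i\<le>length w. kc (take i w @ drop i w) * c (wc (take i w @ drop i w)) * (f (take i w) * g (drop i w)))"
    by (simp add: kappa_def char_scale_def sum_distrib_left mult_ac)
  also have "\<dots> = (\<Sum>i\<le>length w. (\<Sum>t\<in>T. ?d t (take i w) (drop i w)) * (f (take i w) * g (drop i w)))"
    by (rule free_mult_cong[OF f g coeff])
  also have "\<dots> = (\<Sum>i\<le>length w. \<Sum>t\<in>T. ?d t (take i w) (drop i w) * (f (take i w) * g (drop i w)))"
    by (simp only: sum_distrib_right)
  also have "\<dots> = (\<Sum>t\<in>T. \<Sum>i\<le>length w. ?d t (take i w) (drop i w) * (f (take i w) * g (drop i w)))"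
    by (rule sum.swap)
  finally show "\<kappa> (char_scale c (f \<otimes>\<^bsub>R\<^esub> g)) w =
      (\<Sum>t\<in>T. (\<kappa> (char_scale (a t) f) \<otimes>\<^bsub>R\<^esub> \<kappa> (char_scale (b t) g)) w)"
    unfolding free_algebra_simps kappa_def char_scale_def by (simp only: mult_ac)
qed

text \<open>
  Fourier inversion on \<open>V\<close>: the coefficients in the sum are those of \<open>\<Sum>\<^sub>\<psi> c(\<psi>) e\<^sub>\<psi>\<close> in \<open>k[V]\<close>, and that
  element acts on a component of character \<open>\<phi>\<close> by \<open>c(\<phi>)\<close>.
\<close>

lemma char_scale_fourier:
  assumes f: "f \<in> carrier R"
  shows "char_scale c f w =
    (\<Sum>v\<in>V. (\<Sum>\<psi>\<in>carrier chars. c \<psi> * char_idem \<V> \<psi> v) * char_scale (\<lambda>\<psi>. \<psi> v) f w)"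
proof (cases "f w = 0")
  case False
  then have w: "wc w \<in> carrier chars" using f word_char_closed by (auto simp: free_algebra_carrier)
  have "(\<Sum>v\<in>V. (\<Sum>\<psi>\<in>carrier chars. c \<psi> * char_idem \<V> \<psi> v) * wc w v)
    = (\<Sum>v\<in>V. \<Sum>\<psi>\<in>carrier chars. c \<psi> * (char_idem \<V> \<psi> v * wc w v))"
    by (simp add: sum_distrib_right mult.assoc)
  also have "\<dots> = (\<Sum>\<psi>\<in>carrier chars. \<Sum>v\<in>V. c \<psi> * (char_idem \<V> \<psi> v * wc w v))"
    by (rule sum.swap)
  also have "\<dots> = (\<Sum>\<psi>\<in>carrier chars. c \<psi> * (\<Sum>v\<in>V. char_idem \<V> \<psi> v * wc w v))"
    by (simp add: sum_distrib_left)
  also have "\<dots> = (\<Sum>\<psi>\<in>carrier chars. if \<psi> = wc w then c \<psi> else 0)"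
    by (intro sum.cong refl) (simp add: char_idem_eval w)
  also have "\<dots> = c (wc w)" using finite_chars w by simp
  finally have "c (wc w) * f w = (\<Sum>v\<in>V. (\<Sum>\<psi>\<in>carrier chars. c \<psi> * char_idem \<V> \<psi> v) * wc w v) * f w"
    by simp
  then show ?thesis by (simp only: char_scale_def sum_distrib_right[of _ V] mult.assoc)
qed (simp add: char_scale_def)

text \<open>
  \<open>\<kappa>\<close> is not a ring homomorphism, so the elements that it maps into \<open>L\<close> need not form an ideal.
  Those whose image stays in \<open>L\<close> after every rescaling of their components do, and by stability the
  relators are among them.
\<close>

lemma kappa_genideal:
  assumes P: "P \<subseteq> carrier R"
    and stable: "\<And>f v. \<lbrakk>f \<in> linear_span R P; v \<in> V\<rbrakk> \<Longrightarrow> char_scale (\<lambda>\<psi>. \<psi> v) f \<in> linear_span R P"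
    and L: "ideal L R" and PL: "\<kappa> ` P \<subseteq> L" and f: "f \<in> genideal R P"
  shows "\<kappa> f \<in> L"
proof -
  interpret L: ideal L R by fact
  have L_zero: "(\<lambda>w. 0) \<in> L" using additive_subgroup.zero_closed[OF L.is_additive_subgroup] by simp
  have L_add: "(\<lambda>w. g w + h w) \<in> L" if "g \<in> L" "h \<in> L" for g h
    using additive_subgroup.a_closed[OF L.is_additive_subgroup that] by simp
  have L_smult: "(\<lambda>w. c * g w) \<in> L" if "g \<in> L" for c g
    using R.ideal_smult_closed[OF L that, of c] by simp
  have \<kappa>_zero: "\<kappa> (\<lambda>w. 0) = (\<lambda>w. 0)" by (simp add: kappa_def)
  have \<kappa>_add: "\<kappa> (\<lambda>w. g w + h w) = (\<lambda>w. \<kappa> g w + \<kappa> h w)" for g h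
    by (simp add: kappa_def algebra_simps)
  have \<kappa>_smult: "\<kappa> (\<lambda>w. c * g w) = (\<lambda>w. c * \<kappa> g w)" for c g
    by (simp add: kappa_def algebra_simps)
  have span: "linear_span R P \<subseteq> {g \<in> carrier R. \<kappa> g \<in> L}"
  proof -
    have "submodule {g \<in> carrier R. \<kappa> g \<in> L} (scalar_ring :: 'k ring) R"
    proof (rule R.submodule_fromI)
      show "\<zero>\<^bsub>R\<^esub> \<in> {g \<in> carrier R. \<kappa> g \<in> L}"
        using R.zero_closed L_zero by (simp add: \<kappa>_zero)
      show "g \<oplus>\<^bsub>R\<^esub> h \<in> {g \<in> carrier R. \<kappa> g \<in> L}"
        if "g \<in> {g \<in> carrier R. \<kappa> g \<in> L}" "h \<in> {g \<in> carrier R. \<kappa> g \<in> L}" for g h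
        using that R.a_closed[of g h] L_add by (simp add: \<kappa>_add)
      show "c \<odot>\<^bsub>R\<^esub> g \<in> {g \<in> carrier R. \<kappa> g \<in> L}"
        if "g \<in> {g \<in> carrier R. \<kappa> g \<in> L}" for c g
        using that R.smult_closed'[of g c] L_smult by (simp add: \<kappa>_smult)
    qed auto
    then show ?thesis using P PL unfolding linear_span_def by blast
  qed
  have P_span: "P \<subseteq> linear_span R P" unfolding linear_span_def by blast
  let ?M = "{g \<in> carrier R. \<forall>c. \<kappa> (char_scale c g) \<in> L}"
  have PM: "\<kappa> (char_scale c p) \<in> L" if p: "p \<in> P" for p c
  proof -
    have "\<kappa> (char_scale (\<lambda>\<psi>. \<psi> v) p) \<in> L" if "v \<in> V" for v
      using stable[of p v] span P_span p that by blast
    then have "(\<lambda>w. \<Sum>v\<in>V. (\<Sum>\<psi>\<in>carrier chars. c \<psi> * char_idem \<V> \<psi> v) * \<kappa> (char_scale (\<lambda>\<psi>. \<psi> v) p) w) \<in> L"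
      by (intro free_ideal_sum_closed[OF L] finite_V L_smult)
    moreover have "\<kappa> (char_scale c p) =
      (\<lambda>w. \<Sum>v\<in>V. (\<Sum>\<psi>\<in>carrier chars. c \<psi> * char_idem \<V> \<psi> v) * \<kappa> (char_scale (\<lambda>\<psi>. \<psi> v) p) w)"
    proof
      fix w
      have "\<kappa> (char_scale c p) w = kc w * char_scale c p w" by (simp add: kappa_def)
      also have "\<dots> = kc w * (\<Sum>v\<in>V. (\<Sum>\<psi>\<in>carrier chars. c \<psi> * char_idem \<V> \<psi> v) * char_scale (\<lambda>\<psi>. \<psi> v) p w)"
        using char_scale_fourier[of p c w] P p by auto
      also have "\<dots> = (\<Sum>v\<in>V. (\<Sum>\<psi>\<in>carrier chars. c \<psi> * char_idem \<V> \<psi> v) * \<kappa> (char_scale (\<lambda>\<psi>. \<psi> v) p) w)"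
        unfolding sum_distrib_left[of _ _ V] by (intro sum.cong refl) (simp only: kappa_def mult_ac)
      finally show "\<kappa> (char_scale c p) w =
        (\<Sum>v\<in>V. (\<Sum>\<psi>\<in>carrier chars. c \<psi> * char_idem \<V> \<psi> v) * \<kappa> (char_scale (\<lambda>\<psi>. \<psi> v) p) w)" .
    qed
    ultimately show ?thesis by simp
  qed
  have "ideal ?M R"
  proof (rule R.ideal_fromI)
    show "\<zero>\<^bsub>R\<^esub> \<in> ?M"
      using R.zero_closed L_zero by (simp add: char_scale_def \<kappa>_zero)
    show "g \<oplus>\<^bsub>R\<^esub> h \<in> ?M" if "g \<in> ?M" "h \<in> ?M" for g h
    proof -
      have "char_scale c (\<lambda>w. g w + h w) = (\<lambda>w. char_scale c g w + char_scale c h w)" for c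
        by (simp add: char_scale_def algebra_simps)
      then show ?thesis using that R.a_closed[of g h] L_add by (simp add: \<kappa>_add)
    qed
    show "d \<odot>\<^bsub>R\<^esub> g \<in> ?M" if "g \<in> ?M" for d g
    proof -
      have "char_scale c (\<lambda>w. d * g w) = (\<lambda>w. d * char_scale c g w)" for c
        by (simp add: char_scale_def algebra_simps)
      then show ?thesis using that R.smult_closed'[of g d] L_smult by (simp add: \<kappa>_smult)
    qed
    \<comment> \<open>Splitting the other factor into components \<open>?e \<psi>\<close> freezes one argument of \<open>\<sigma>\<close>, and
      what remains is a rescaling of \<open>g\<close>.\<close>
    let ?e = "\<lambda>\<psi> \<phi>. if \<psi> = \<phi> then 1 else (0::'k)"
    show "h \<otimes>\<^bsub>R\<^esub> g \<in> ?M" if g: "g \<in> ?M" and h: "h \<in> carrier R" for g h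
    proof -
      have gR: "g \<in> carrier R" using g by blast
      have "\<kappa> (char_scale c (h \<otimes>\<^bsub>R\<^esub> g)) = (\<lambda>w. \<Sum>\<psi>\<in>carrier chars. (\<kappa> (char_scale (?e \<psi>) h) \<otimes>\<^bsub>R\<^esub>
          \<kappa> (char_scale (\<lambda>\<phi>. c (\<psi> \<otimes>\<^bsub>chars\<^esub> \<phi>) * inverse (\<sigma> \<psi> \<phi>)) g)) w)" for c
        by (rule kappa_char_scale_mult[OF h gR])
          (simp add: if_distrib[of "\<lambda>x. x * y" for y] finite_chars cong: if_cong)
      moreover have "(\<lambda>w. \<Sum>\<psi>\<in>carrier chars. (\<kappa> (char_scale (?e \<psi>) h) \<otimes>\<^bsub>R\<^esub>
          \<kappa> (char_scale (\<lambda>\<phi>. c (\<psi> \<otimes>\<^bsub>chars\<^esub> \<phi>) * inverse (\<sigma> \<psi> \<phi>)) g)) w) \<in> L" for c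
        using g h by (intro free_ideal_sum_closed[OF L] finite_chars L.I_l_closed kappa_closed char_scale_closed) auto
      ultimately show ?thesis using R.m_closed[OF h gR] by simp
    qed
    show "g \<otimes>\<^bsub>R\<^esub> h \<in> ?M" if g: "g \<in> ?M" and h: "h \<in> carrier R" for g h
    proof -
      have gR: "g \<in> carrier R" using g by blast
      have "\<kappa> (char_scale c (g \<otimes>\<^bsub>R\<^esub> h)) = (\<lambda>w. \<Sum>\<psi>\<in>carrier chars.
          (\<kappa> (char_scale (\<lambda>\<phi>. c (\<phi> \<otimes>\<^bsub>chars\<^esub> \<psi>) * inverse (\<sigma> \<phi> \<psi>)) g) \<otimes>\<^bsub>R\<^esub> \<kappa> (char_scale (?e \<psi>) h)) w)" for c
        by (rule kappa_char_scale_mult[OF gR h])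
          (simp add: if_distrib[of "\<lambda>x. y * x" for y] finite_chars cong: if_cong)
      moreover have "(\<lambda>w. \<Sum>\<psi>\<in>carrier chars.
          (\<kappa> (char_scale (\<lambda>\<phi>. c (\<phi> \<otimes>\<^bsub>chars\<^esub> \<psi>) * inverse (\<sigma> \<phi> \<psi>)) g) \<otimes>\<^bsub>R\<^esub> \<kappa> (char_scale (?e \<psi>) h)) w) \<in> L" for c
        using g h by (intro free_ideal_sum_closed[OF L] finite_chars L.I_r_closed kappa_closed char_scale_closed) auto
      ultimately show ?thesis using R.m_closed[OF gR h] by simp
    qed
  qed auto
  moreover have "P \<subseteq> ?M" using P PM by blast
  ultimately have "genideal R P \<subseteq> ?M" by (rule R.genideal_minimal)
  with f have "\<kappa> (char_scale (\<lambda>\<psi>. 1) f) \<in> L" by blast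
  then show ?thesis by (simp add: char_scale_def)
qed

section \<open>The twisted algebra as an image of the free algebra\<close>

text \<open>
  Both sides are homomorphisms from the free algebra that agree on the generators.  With \<open>A\<close> the free
  algebra and \<open>\<pi>\<close> the identity, this also identifies the action on the free algebra itself.
\<close>

lemma act_image:
  fixes A :: "('k, 'a, 'l) module_scheme"
  assumes act: "right_G_algebra A H act" and t: "t \<in> V" and tH: "t \<in> carrier H"
    and \<pi>: "\<pi> \<in> alg_hom R A"
    and eigen: "\<And>j. j \<in> {1..n} \<Longrightarrow> act (\<pi> (free_gen j)) t = \<chi> j t \<odot>\<^bsub>A\<^esub> \<pi> (free_gen j)"
    and f: "f \<in> carrier R"
  shows "act (\<pi> f) t = \<pi> (char_scale (\<lambda>\<psi>. \<psi> t) f)"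
proof -
  interpret A: right_G_algebra A H act by fact
  have "(\<lambda>f. act (\<pi> f) t) \<in> alg_hom R A"
    using alg_hom_compose[OF \<pi> alg_iso_alg_hom[OF A.act_aut[OF tH]]] .
  moreover have "(\<lambda>f. \<pi> (char_scale (\<lambda>\<psi>. \<psi> t) f)) \<in> alg_hom R A"
    by (rule alg_hom_compose[OF char_scale_alg_hom[OF t] \<pi>])
  moreover have "act (\<pi> (free_gen j)) t = \<pi> (char_scale (\<lambda>\<psi>. \<psi> t) (free_gen j))" if j: "j \<in> {1..n}" for j
    using eigen[OF j] alg_hom_smult[OF \<pi> free_gen_closed[OF j], of "\<chi> j t"] char_scale_gen[OF j, of "\<lambda>\<psi>. \<psi> t"]
    by simp
  ultimately show ?thesis
    using free_algebra_hom_unique[OF A.assoc_algebra_axioms _ _ _ f] by blast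
qed

text \<open>
  Only \<open>t \<in> V \<times> V\<close> contribute to the product in \<open>A\<^sub>F\<close>, and such \<open>t\<close> act on words through their
  characters; summing over \<open>t\<close> evaluates \<open>F\<close> at these characters.
\<close>

lemma twisted_mult_image:
  fixes A :: "('k, 'a, 'l) module_scheme"
  assumes act: "right_G_algebra A G act" and \<pi>: "\<pi> \<in> alg_hom R A"
    and eigen: "\<And>j v. \<lbrakk>j \<in> {1..n}; v \<in> V\<rbrakk> \<Longrightarrow> act (\<pi> (free_gen j)) v = \<chi> j v \<odot>\<^bsub>A\<^esub> \<pi> (free_gen j)"
    and f: "f \<in> carrier R" and g: "g \<in> carrier R"
  shows "\<pi> f \<otimes>\<^bsub>twisted_algebra G \<V> F \<sigma> act A\<^esub> \<pi> g =
    \<pi> (\<lambda>w. \<Sum>i\<le>length w. \<sigma> (wc (take i w)) (wc (drop i w)) * (f (take i w) * g (drop i w)))"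
proof -
  interpret A: right_G_algebra A G act by fact
  let ?D = "\<lambda>t. char_scale (\<lambda>\<psi>. \<psi> t)"
  let ?p = "\<lambda>t. act (\<pi> f) (fst t) \<otimes>\<^bsub>A\<^esub> act (\<pi> g) (snd t)"
  have p_closed: "?p t \<in> carrier A" if "t \<in> carrier (G \<times>\<times> G)" for t
  proof -
    have "act a v \<in> carrier A" if "a \<in> carrier A" "v \<in> carrier G" for a v
      using alg_hom_closed[OF alg_iso_alg_hom[OF A.act_aut[OF that(2)]] that(1)] .
    then show ?thesis using that alg_hom_closed[OF \<pi>] f g by (auto simp: DirProd_def)
  qed
  have p_eq: "?p t = \<pi> (?D (fst t) f \<otimes>\<^bsub>R\<^esub> ?D (snd t) g)" if t: "t \<in> V \<times> V" for t
  proof -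
    from t have V: "fst t \<in> V" "snd t \<in> V" by auto
    then have G: "fst t \<in> carrier G" "snd t \<in> carrier G" using V_subset by auto
    have "act (\<pi> f) (fst t) = \<pi> (?D (fst t) f)"
      by (rule act_image[OF act V(1) G(1) \<pi> eigen f]) (use V in auto)
    moreover have "act (\<pi> g) (snd t) = \<pi> (?D (snd t) g)"
      by (rule act_image[OF act V(2) G(2) \<pi> eigen g]) (use V in auto)
    ultimately show ?thesis
      using alg_hom_mult[OF \<pi> char_scale_closed[OF f] char_scale_closed[OF g]] by metis
  qed
  have "\<pi> f \<otimes>\<^bsub>twisted_algebra G \<V> F \<sigma> act A\<^esub> \<pi> g = (\<Oplus>\<^bsub>A\<^esub>t\<in>carrier (G \<times>\<times> G). F t \<odot>\<^bsub>A\<^esub> ?p t)"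
    by (simp add: twisted_algebra_def)
  also have "\<dots> = (\<Oplus>\<^bsub>A\<^esub>t\<in>V \<times> V. F t \<odot>\<^bsub>A\<^esub> \<pi> (?D (fst t) f \<otimes>\<^bsub>R\<^esub> ?D (snd t) g))"
  proof (rule A.add.finprod_mono_neutral_cong_right)
    show "finite (carrier (G \<times>\<times> G))" using finite_G by simp
    show "V \<times> V \<subseteq> carrier (G \<times>\<times> G)" using V_subset by auto
    show "F t \<odot>\<^bsub>A\<^esub> ?p t = \<zero>\<^bsub>A\<^esub>" if "t \<in> carrier (G \<times>\<times> G) - V \<times> V" for t
      using A.smult_zero[OF p_closed[of t]] F_support[of t] that by simp
    show "F t \<odot>\<^bsub>A\<^esub> ?p t = F t \<odot>\<^bsub>A\<^esub> \<pi> (?D (fst t) f \<otimes>\<^bsub>R\<^esub> ?D (snd t) g)" if "t \<in> V \<times> V" for t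
      by (simp only: p_eq[OF that])
    show "(\<lambda>t. F t \<odot>\<^bsub>A\<^esub> ?p t) \<in> carrier (G \<times>\<times> G) \<rightarrow> carrier A"
      using p_closed A.smult_closed' by simp
  qed
  also have "\<dots> = \<pi> (\<lambda>w. \<Sum>t\<in>V \<times> V. F t * (?D (fst t) f \<otimes>\<^bsub>R\<^esub> ?D (snd t) g) w)"
    using free_algebra_hom_sum[OF A.assoc_algebra_axioms \<pi>, of "V \<times> V"
      "\<lambda>t. ?D (fst t) f \<otimes>\<^bsub>R\<^esub> ?D (snd t) g" F] finite_V
      R.m_closed[OF char_scale_closed[OF f] char_scale_closed[OF g]]
    by (simp only: finite_cartesian_product)
  also have "(\<lambda>w. \<Sum>t\<in>V \<times> V. F t * (?D (fst t) f \<otimes>\<^bsub>R\<^esub> ?D (snd t) g) w) =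
    (\<lambda>w. \<Sum>i\<le>length w. \<sigma> (wc (take i w)) (wc (drop i w)) * (f (take i w) * g (drop i w)))"
  proof
    fix w
    have "(\<Sum>t\<in>V \<times> V. F t * (?D (fst t) f \<otimes>\<^bsub>R\<^esub> ?D (snd t) g) w) =
      (\<Sum>t\<in>V \<times> V. \<Sum>i\<le>length w. F t * (wc (take i w) (fst t) * wc (drop i w) (snd t)) * (f (take i w) * g (drop i w)))"
      by (simp add: char_scale_def sum_distrib_left mult_ac)
    also have "\<dots> = (\<Sum>i\<le>length w. \<Sum>t\<in>V \<times> V. F t * (wc (take i w) (fst t) * wc (drop i w) (snd t)) * (f (take i w) * g (drop i w)))"
      by (rule sum.swap)
    also have "\<dots> = (\<Sum>i\<le>length w. (\<Sum>t\<in>V \<times> V. F t * (wc (take i w) (fst t) * wc (drop i w) (snd t))) * (f (take i w) * g (drop i w)))"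
      by (simp only: sum_distrib_right)
    also have "\<dots> = (\<Sum>i\<le>length w. \<sigma> (wc (take i w)) (wc (drop i w)) * (f (take i w) * g (drop i w)))"
      by (rule free_mult_cong[OF f g]) (simp add: sigma_eval word_char_closed)
    finally show "(\<Sum>t\<in>V \<times> V. F t * (?D (fst t) f \<otimes>\<^bsub>R\<^esub> ?D (snd t) g) w) =
      (\<Sum>i\<le>length w. \<sigma> (wc (take i w)) (wc (drop i w)) * (f (take i w) * g (drop i w)))" .
  qed
  finally show ?thesis .
qed

lemma twisted_mult_gens:
  fixes A :: "('k, 'a, 'l) module_scheme"
  assumes act: "right_G_algebra A G act" and \<pi>: "\<pi> \<in> alg_hom R A"
    and eigen: "\<And>j v. \<lbrakk>j \<in> {1..n}; v \<in> V\<rbrakk> \<Longrightarrow> act (\<pi> (free_gen j)) v = \<chi> j v \<odot>\<^bsub>A\<^esub> \<pi> (free_gen j)"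
    and i: "i \<in> {1..n}" and j: "j \<in> {1..n}"
  shows "\<pi> (free_gen i) \<otimes>\<^bsub>twisted_algebra G \<V> F \<sigma> act A\<^esub> \<pi> (free_gen j) =
    \<sigma> (\<chi> i) (\<chi> j) \<odot>\<^bsub>A\<^esub> (\<pi> (free_gen i) \<otimes>\<^bsub>A\<^esub> \<pi> (free_gen j))"
proof -
  have "(\<lambda>w. \<Sum>l\<le>length w. \<sigma> (wc (take l w)) (wc (drop l w)) * (free_gen i (take l w) * free_gen j (drop l w)))
    = \<sigma> (\<chi> i) (\<chi> j) \<odot>\<^bsub>R\<^esub> (free_gen i \<otimes>\<^bsub>R\<^esub> free_gen j)"
    unfolding free_algebra_simps sum_distrib_left
    by (intro ext sum.cong refl) (simp add: free_gen_def word_char_single[OF i] word_char_single[OF j])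
  then show ?thesis
    using twisted_mult_image[OF act \<pi> eigen free_gen_closed[OF i] free_gen_closed[OF j]]
      alg_hom_smult[OF \<pi> R.m_closed[OF free_gen_closed[OF i] free_gen_closed[OF j]], of "\<sigma> (\<chi> i) (\<chi> j)"]
      alg_hom_mult[OF \<pi> free_gen_closed[OF i] free_gen_closed[OF j]]
    by (simp del: free_algebra_simps)
qed

lemma twisted_hom:
  fixes A :: "('k, 'a, 'l) module_scheme"
  assumes act: "right_G_algebra A G act" and \<pi>: "\<pi> \<in> alg_hom R A"
    and eigen: "\<And>j v. \<lbrakk>j \<in> {1..n}; v \<in> V\<rbrakk> \<Longrightarrow> act (\<pi> (free_gen j)) v = \<chi> j v \<odot>\<^bsub>A\<^esub> \<pi> (free_gen j)"
  shows "(\<lambda>f. \<pi> (unkappa f)) \<in> alg_hom R (twisted_algebra G \<V> F \<sigma> act A)"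
proof (rule alg_homI)
  let ?B = "twisted_algebra G \<V> F \<sigma> act A"
  fix f assume f: "f \<in> carrier R"
  show "\<pi> (unkappa f) \<in> carrier ?B"
    using alg_hom_closed[OF \<pi> unkappa_closed[OF f]] by (simp add: twisted_algebra_def)
  have "unkappa (c \<odot>\<^bsub>R\<^esub> f) = c \<odot>\<^bsub>R\<^esub> unkappa f" for c
    by (simp add: unkappa_def mult_ac)
  then show "\<pi> (unkappa (c \<odot>\<^bsub>R\<^esub> f)) = c \<odot>\<^bsub>?B\<^esub> \<pi> (unkappa f)" for c
    using alg_hom_smult[OF \<pi> unkappa_closed[OF f], of c] by (simp add: twisted_algebra_def del: free_algebra_simps)
  fix g assume g: "g \<in> carrier R"
  show "\<pi> (unkappa (f \<otimes>\<^bsub>R\<^esub> g)) = \<pi> (unkappa f) \<otimes>\<^bsub>?B\<^esub> \<pi> (unkappa g)"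
    using twisted_mult_image[OF act \<pi> eigen unkappa_closed[OF f] unkappa_closed[OF g]] unkappa_mult[OF f g]
    by (simp del: free_algebra_simps)
  have "unkappa (f \<oplus>\<^bsub>R\<^esub> g) = unkappa f \<oplus>\<^bsub>R\<^esub> unkappa g"
    by (simp add: unkappa_def algebra_simps)
  then show "\<pi> (unkappa (f \<oplus>\<^bsub>R\<^esub> g)) = \<pi> (unkappa f) \<oplus>\<^bsub>?B\<^esub> \<pi> (unkappa g)"
    using alg_hom_add[OF \<pi> unkappa_closed[OF f] unkappa_closed[OF g]]
    by (simp add: twisted_algebra_def del: free_algebra_simps)
next
  have "unkappa \<one>\<^bsub>R\<^esub> = inverse (\<sigma> \<one>\<^bsub>chars\<^esub> \<one>\<^bsub>chars\<^esub>) \<odot>\<^bsub>R\<^esub> \<one>\<^bsub>R\<^esub>"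
    by (auto simp: unkappa_def free_word_def kappa_coeff_def)
  then show "\<pi> (unkappa \<one>\<^bsub>R\<^esub>) = \<one>\<^bsub>twisted_algebra G \<V> F \<sigma> act A\<^esub>"
    using alg_hom_smult[OF \<pi> R.one_closed] alg_hom_one[OF \<pi>]
    by (simp add: twisted_algebra_def del: free_algebra_simps)
qed

text \<open>
  The presentation is given by \<open>\<pi> \<circ> \<kappa>\<inverse>\<close>, whose kernel is compared with the ideal generated by the
  image of the relators under \<open>\<kappa>\<close>.
\<close>

lemma twisted_presentation:
  fixes A :: "('k, 'a, 'l) module_scheme"
  assumes act: "right_G_algebra A G act" and P: "P \<subseteq> carrier R" and pres: "presented_as A n x P"
    and eigen: "\<And>j v. \<lbrakk>j \<in> {1..n}; v \<in> V\<rbrakk> \<Longrightarrow> act (x j) v = \<chi> j v \<odot>\<^bsub>A\<^esub> x j"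
    and stable: "\<And>f v. \<lbrakk>f \<in> linear_span R P; v \<in> V\<rbrakk> \<Longrightarrow> char_scale (\<lambda>\<psi>. \<psi> v) f \<in> linear_span R P"
  shows "presented_as (twisted_algebra G \<V> F \<sigma> act A) n x (\<kappa> ` P)"
    and "\<And>i j. \<lbrakk>i \<in> {1..n}; j \<in> {1..n}\<rbrakk> \<Longrightarrow>
      x i \<otimes>\<^bsub>twisted_algebra G \<V> F \<sigma> act A\<^esub> x j = \<sigma> (\<chi> i) (\<chi> j) \<odot>\<^bsub>A\<^esub> (x i \<otimes>\<^bsub>A\<^esub> x j)"
proof -
  let ?B = "twisted_algebra G \<V> F \<sigma> act A"
  from pres obtain \<pi> where A: "assoc_algebra A" and \<pi>: "\<pi> \<in> alg_hom R A"
    and surj: "\<pi> ` carrier R = carrier A" and ker: "a_kernel R A \<pi> = genideal R P"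
    and gens: "\<And>j. j \<in> {1..n} \<Longrightarrow> \<pi> (free_gen j) = x j"
    unfolding presented_as_iff[OF P] by blast
  have eigen': "act (\<pi> (free_gen j)) v = \<chi> j v \<odot>\<^bsub>A\<^esub> \<pi> (free_gen j)" if "j \<in> {1..n}" "v \<in> V" for j v
    using eigen[OF that] by (simp only: gens[OF that(1)])
  show "x i \<otimes>\<^bsub>?B\<^esub> x j = \<sigma> (\<chi> i) (\<chi> j) \<odot>\<^bsub>A\<^esub> (x i \<otimes>\<^bsub>A\<^esub> x j)" if "i \<in> {1..n}" "j \<in> {1..n}" for i j
    using twisted_mult_gens[OF act \<pi> eigen' that] by (simp only: gens that)
  let ?\<rho> = "\<lambda>f. \<pi> (unkappa f)"
  have \<rho>: "?\<rho> \<in> alg_hom R ?B" by (rule twisted_hom[OF act \<pi> eigen'])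
  have B_carrier: "carrier ?B = carrier A" and B_zero: "\<zero>\<^bsub>?B\<^esub> = \<zero>\<^bsub>A\<^esub>"
    by (simp_all add: twisted_algebra_def)
  have \<rho>_surj: "?\<rho> ` carrier R = carrier ?B"
  proof -
    have "unkappa ` carrier R = carrier R"
    proof
      show "carrier R \<subseteq> unkappa ` carrier R"
        using unkappa_kappa(1) kappa_closed by (metis imageI subsetI)
    qed (use unkappa_closed in blast)
    then have "\<pi> ` unkappa ` carrier R = carrier A" using surj by metis
    then show ?thesis by (simp only: image_image B_carrier)
  qed
  have "unkappa \<zero>\<^bsub>R\<^esub> = \<zero>\<^bsub>R\<^esub>" by (simp add: unkappa_def)
  then have \<rho>_zero: "?\<rho> \<zero>\<^bsub>R\<^esub> = \<zero>\<^bsub>?B\<^esub>"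
    using alg_hom_zero[OF free_algebra_assoc_algebra A \<pi>] B_zero by metis
  have B: "assoc_algebra ?B"
    by (rule assoc_algebra_surj_image[where h = ?\<rho>, OF free_algebra_assoc_algebra \<rho> \<rho>_surj \<rho>_zero])
  interpret B: assoc_algebra ?B by (rule B)
  have ideal_ker: "ideal (a_kernel R ?B ?\<rho>) R"
    using R.ring_axioms B.ring_axioms alg_hom_ring_hom[OF \<rho>]
    by (intro ring_hom_ring.kernel_is_ideal ring_hom_ringI2)
  have \<kappa>P: "\<kappa> ` P \<subseteq> carrier R" using P kappa_closed by blast
  interpret L: ideal "genideal R (\<kappa> ` P)" R by (rule R.genideal_ideal[OF \<kappa>P])
  have mem_ker: "f \<in> a_kernel R ?B ?\<rho> \<longleftrightarrow> f \<in> carrier R \<and> unkappa f \<in> genideal R P" for f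
    unfolding ker[symmetric] a_kernel_def' B_zero using unkappa_closed[of f] by blast
  have "a_kernel R ?B ?\<rho> = genideal R (\<kappa> ` P)"
  proof
    have "\<kappa> ` P \<subseteq> a_kernel R ?B ?\<rho>"
    proof
      fix f assume "f \<in> \<kappa> ` P"
      then obtain p where p: "p \<in> P" "f = \<kappa> p" by blast
      then have "p \<in> carrier R" using P by blast
      then show "f \<in> a_kernel R ?B ?\<rho>"
        unfolding mem_ker p(2) using kappa_closed unkappa_kappa(1) R.genideal_self[OF P] p(1) by auto
    qed
    then show "genideal R (\<kappa> ` P) \<subseteq> a_kernel R ?B ?\<rho>"
      by (rule R.genideal_minimal[OF ideal_ker])
    show "a_kernel R ?B ?\<rho> \<subseteq> genideal R (\<kappa> ` P)"
    proof
      fix f assume "f \<in> a_kernel R ?B ?\<rho>"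
      then have f: "f \<in> carrier R" "unkappa f \<in> genideal R P" unfolding mem_ker by auto
      have "\<kappa> (unkappa f) \<in> genideal R (\<kappa> ` P)"
        by (rule kappa_genideal[OF P stable L.is_ideal R.genideal_self[OF \<kappa>P] f(2)])
      then show "f \<in> genideal R (\<kappa> ` P)" by (simp only: unkappa_kappa(2)[OF f(1)])
    qed
  qed
  moreover have "?\<rho> (free_gen j) = x j" if j: "j \<in> {1..n}" for j
  proof -
    have "unkappa (free_gen j) = free_gen j"
      by (auto simp: unkappa_def free_gen_def kappa_coeff_def)
    then show ?thesis using gens[OF j] by simp
  qed
  ultimately show "presented_as ?B n x (\<kappa> ` P)"
    unfolding presented_as_iff[OF \<kappa>P] using B \<rho> \<rho>_surj by blast
qed

end

theorem theorem3p8: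
  fixes G :: "('g, 'm) monoid_scheme"
    and V :: "'g set"
    and N n :: nat
    and \<zeta> :: "'k::field"
    and F :: "'g \<times> 'g \<Rightarrow> 'k"
    and \<sigma> :: "('g \<Rightarrow> 'k) \<Rightarrow> ('g \<Rightarrow> 'k) \<Rightarrow> 'k"
    and A :: "('k, 'a) module"
    and act :: "'a \<Rightarrow> 'g \<Rightarrow> 'a"
    and x :: "nat \<Rightarrow> 'a"
    and \<chi> :: "nat \<Rightarrow> 'g \<Rightarrow> 'k"
    and I :: "'i set"
    and p :: "'i \<Rightarrow> nat list \<Rightarrow> 'k"
    and free_act :: "(nat list \<Rightarrow> 'k) \<Rightarrow> 'g \<Rightarrow> nat list \<Rightarrow> 'k"
  assumes "group G" and "finite (carrier G)"
    and "V \<lhd> G" and "comm_group (G\<lparr>carrier := V\<rparr>)" and "has_exponent (G\<lparr>carrier := V\<rparr>) N"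
    and "primitive_root_of_unity N \<zeta>"
    and "F \<in> carrier (group_algebra (G\<lparr>carrier := V\<rparr> \<times>\<times> (G\<lparr>carrier := V\<rparr>)))"
    and "invariant_twist G F"
    and "twist_cocycle (G\<lparr>carrier := V\<rparr>) F \<sigma>"
    and "\<And>i. i \<in> I \<Longrightarrow> p i \<in> carrier (free_algebra n)"
    and "presented_as A n x (p ` I)"
    and "right_G_algebra A G act"
    and "\<And>j. j \<in> {1..n} \<Longrightarrow> \<chi> j \<in> carrier (char_group (G\<lparr>carrier := V\<rparr>))"
    and "\<And>j v. \<lbrakk>j \<in> {1..n}; v \<in> V\<rbrakk> \<Longrightarrow> act (x j) v = \<chi> j v \<odot>\<^bsub>A\<^esub> x j"
    and "right_G_algebra (free_algebra n :: ('k, nat list \<Rightarrow> 'k) module) (G\<lparr>carrier := V\<rparr>) free_act"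
    and "\<And>j v. \<lbrakk>j \<in> {1..n}; v \<in> V\<rbrakk> \<Longrightarrow>
          free_act (free_gen j) v = \<chi> j v \<odot>\<^bsub>free_algebra n :: ('k, nat list \<Rightarrow> 'k) module\<^esub> free_gen j"
    and "\<And>f v. \<lbrakk>f \<in> linear_span (free_algebra n) (p ` I); v \<in> V\<rbrakk> \<Longrightarrow>
          free_act f v \<in> linear_span (free_algebra n) (p ` I)"
  shows "let A_F = twisted_algebra G (G\<lparr>carrier := V\<rparr>) F \<sigma> act A in
    presented_as A_F n x ((\<lambda>i. kappa (G\<lparr>carrier := V\<rparr>) \<sigma> \<chi> (p i)) ` I)
    \<and> (\<forall>i\<in>{1..n}. \<forall>j\<in>{1..n}. x i \<otimes>\<^bsub>A\<^esub> x j = x j \<otimes>\<^bsub>A\<^esub> x i \<longrightarrow>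
         x i \<otimes>\<^bsub>A_F\<^esub> x j = cocycle_b \<sigma> (\<chi> j) (\<chi> i) \<odot>\<^bsub>A_F\<^esub> (x j \<otimes>\<^bsub>A_F\<^esub> x i))"
proof -
  let ?V = "G\<lparr>carrier := V\<rparr>"
  let ?A = "twisted_algebra G ?V F \<sigma> act A"
  have V: "subgroup V G" using \<open>V \<lhd> G\<close> by (rule normal_imp_subgroup)
  interpret graded_generators G V F \<sigma> n \<chi>
    using assms(1,2,7,8,9,13) V
    by (intro graded_generators.intro subgroup_twist.intro subgroup_twist_axioms.intro graded_generators_axioms.intro)
      (auto simp: invariant_twist_def)
  have P: "p ` I \<subseteq> carrier R" using assms(10) by blast
  have span: "linear_span R (p ` I) \<subseteq> carrier R"
  proof -
    have "submodule (carrier R) (scalar_ring :: 'k ring) R"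
      by (rule R.submodule_fromI) (simp_all only: subset_refl R.zero_closed R.a_closed R.smult_closed')
    then show ?thesis using P unfolding linear_span_def by blast
  qed
  have stable: "char_scale (\<lambda>\<psi>. \<psi> v) f \<in> linear_span R (p ` I)"
    if f: "f \<in> linear_span R (p ` I)" and v: "v \<in> V" for f v
  proof -
    have "(\<lambda>f. f) \<in> alg_hom R R" by (rule alg_homI) auto
    then have "free_act f v = char_scale (\<lambda>\<psi>. \<psi> v) f"
      using act_image[OF assms(15) v _ \<open>(\<lambda>f. f) \<in> alg_hom R R\<close> assms(16)[OF _ v]] f span v by auto
    then show ?thesis using assms(17)[OF f v] by simp
  qed
  have "presented_as ?A n x (\<kappa> ` p ` I)"
    by (rule twisted_presentation(1)[OF assms(12) P assms(11) assms(14) stable])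
  then have "presented_as ?A n x ((\<lambda>i. \<kappa> (p i)) ` I)"
    by (simp only: image_image)
  moreover have mult: "x i \<otimes>\<^bsub>?A\<^esub> x j = \<sigma> (\<chi> i) (\<chi> j) \<odot>\<^bsub>A\<^esub> (x i \<otimes>\<^bsub>A\<^esub> x j)"
    if "i \<in> {1..n}" "j \<in> {1..n}" for i j
    by (rule twisted_presentation(2)[OF assms(12) P assms(11) assms(14) stable that])
  moreover have "x i \<otimes>\<^bsub>?A\<^esub> x j = cocycle_b \<sigma> (\<chi> j) (\<chi> i) \<odot>\<^bsub>?A\<^esub> (x j \<otimes>\<^bsub>?A\<^esub> x i)"
    if i: "i \<in> {1..n}" and j: "j \<in> {1..n}" and comm: "x i \<otimes>\<^bsub>A\<^esub> x j = x j \<otimes>\<^bsub>A\<^esub> x i" for i j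
  proof -
    interpret A: right_G_algebra A G act by (rule assms(12))
    obtain \<pi> where \<pi>: "\<pi> \<in> alg_hom R A" "\<forall>j\<in>{1..n}. \<pi> (free_gen j) = x j"
      using assms(11) unfolding presented_as_iff[OF P] by blast
    have x: "x l \<in> carrier A" if "l \<in> {1..n}" for l
      using alg_hom_closed[OF \<pi>(1) free_gen_closed[OF that]] \<pi>(2) that by simp
    have "\<sigma> (\<chi> j) (\<chi> i) \<noteq> 0" by (intro sigma_nonzero gen_char i j)
    then have "\<sigma> (\<chi> i) (\<chi> j) = cocycle_b \<sigma> (\<chi> j) (\<chi> i) * \<sigma> (\<chi> j) (\<chi> i)"
      by (simp add: cocycle_b_def)
    then have "x i \<otimes>\<^bsub>?A\<^esub> x j = cocycle_b \<sigma> (\<chi> j) (\<chi> i) \<odot>\<^bsub>A\<^esub> (\<sigma> (\<chi> j) (\<chi> i) \<odot>\<^bsub>A\<^esub> (x j \<otimes>\<^bsub>A\<^esub> x i))"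
      unfolding mult[OF i j] comm using A.scalar_laws(3)[OF A.m_closed[OF x[OF j] x[OF i]]] by metis
    then show ?thesis
      unfolding mult[OF j i] by (simp add: twisted_algebra_def)
  qed
  ultimately show ?thesis unfolding Let_def by (intro conjI ballI impI)
qed

end
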